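(* Let $\theta<0$ and $\xi\in[0,1]$, and let $p_n^{\theta,\xi}$ ($n\ge1$) be the persistence probabilities defined in the context. Write $P^{\theta,\xi}(z):=\sum_{n=1}^\infty p_n^{\theta,\xi}z^n$ for $z\in\mathbb{C}$, $|z|<1$. Then the following hold. (f) $p_n^{\theta,\xi}=p_n^{1/\theta,\xi}$ for all $n\ge1$. (g) For $\theta=-1$ and $\xi=\frac12$, for $|z|<1$, $$P^{-1,\frac12}(z)=\frac{\frac2z\sin(\frac z2)}{\cos(\frac z2)-\sin(\frac z2)}-1.$$ (h) For any $\theta<0$ and $|z|<1$, $$P^{\theta,\xi}(z)=\frac{1}{z\sqrt{\xi(1-\xi)}}\;\frac{\sin_{-\theta}\bigl(\sqrt{\xi(1-\xi)}\,z\bigr)}{\cos_{-\theta}\bigl(\sqrt{\xi(1-\xi)}\,z\bigr)-\sqrt{\frac{1-\xi}{\xi}}\,\sin_{-\theta}\bigl(\sqrt{\xi(1-\xi)}\,z\bigr)}-1,$$ where for $\xi=0$ and $\xi=1$ the right-hand side is understood as its limit for $\xi\downarrow0$ and $\xi\uparrow1$, respectively. (i) For $\xi\in(0,1)$ and all $n\ge1$, $$p_n^{\theta,\xi}=(\xi(1-\xi))^{n/2}\sum_{r=1}^{n+1}\left[\left(\sqrt{\frac{1-\xi}{\xi}}\right)^{r-1}\sum_{\substack{j_1+\dots+j_r=n+1\\ j_k\geq 1\text{ odd}}}\ \prod_{k=1}^r\frac{E_{j_k}(-\theta)}{[j_k]_{-\theta}!}\right].$$ In (g) and (h) the right-hand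 sides are understood by continuity at $z=0$.
   Context: Let $(X_i)_{i\ge 0}$ be i.i.d. real random variables with density $\xi e^{x}\mathbf 1_{x<0}+(1-\xi)e^{-x}\mathbf 1_{x>0}$, $x\in\mathbb{R}$, where $\xi\in[0,1]$. For $\theta\in\mathbb{R}$ and $n\ge1$ put $$p_n^{\theta,\xi}:=\mathbb{P}(X_1>\theta X_0,\ X_2>\theta X_1,\ \ldots,\ X_n>\theta X_{n-1}).$$ Notation: for $q>0$, $[n]_q!:=\prod_{k=1}^n\frac{1-q^k}{1-q}$ with $[n]_1!=n!$, and $$\cos_q(z):=\sum_{n=0}^\infty\frac{(-1)^nz^{2n}}{[2n]_q!},\qquad \sin_q(z):=\sum_{n=0}^\infty\frac{(-1)^nz^{2n+1}}{[2n+1]_q!},$$ which converge at least for $|z|<1$. Stanley's $q$-analogues $E_n(q)$, $n\ge1$, of Euler's zigzag numbers are defined by the power series identity (around $z=0$) $$\sum_{n=1}^\infty\frac{E_n(q)}{[n]_q!}z^n=\frac{1}{\cos_q(z)}+\frac{\sin_q(z)}{\cos_q(z)}-1.$$ *)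

theory Defs
  imports "HOL-Probability.Probability" "HOL-Computational_Algebra.Formal_Power_Series"
begin

definition two_sided_exp_density :: "real \<Rightarrow> real \<Rightarrow> real" where
  "two_sided_exp_density \<xi> x =
     \<xi> * exp x * indicator {..<0} x + (1 - \<xi>) * exp (- x) * indicator {0<..} x"

definition persistence_prob :: "'a measure \<Rightarrow> (nat \<Rightarrow> 'a \<Rightarrow> real) \<Rightarrow> real \<Rightarrow> nat \<Rightarrow> real" where
  "persistence_prob M X \<theta> n =
     measure M {\<omega> \<in> space M. \<forall>i\<in>{1..n}. X i \<omega> > \<theta> * X (i - 1) \<omega>}"

definition persistence_gf :: "'a measure \<Rightarrow> (nat \<Rightarrow> 'a \<Rightarrow> real) \<Rightarrow> real \<Rightarrow> complex \<Rightarrow> complex" where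
  "persistence_gf M X \<theta> z = (\<Sum>n. complex_of_real (persistence_prob M X \<theta> (Suc n)) * z ^ Suc n)"

lemma summable_persistence_gf:
  assumes "prob_space M" "norm z < 1"
  shows "summable (\<lambda>n. complex_of_real (persistence_prob M X \<theta> (Suc n)) * z ^ Suc n)"
proof (rule summable_comparison_test')
  show "summable (\<lambda>n. norm z ^ Suc n)"
    using assms(2) summable_geometric[of "norm z"] by (subst summable_Suc_iff) auto
  show "norm (complex_of_real (persistence_prob M X \<theta> (Suc n)) * z ^ Suc n) \<le> norm z ^ Suc n"
    if "n \<ge> 0" for n
  proof -
    have "\<bar>persistence_prob M X \<theta> (Suc n)\<bar> \<le> 1"
      using prob_space.prob_le_1[OF assms(1)] by (simp add: persistence_prob_def)
    then have "\<bar>persistence_prob M X \<theta> (Suc n)\<bar> * norm (z ^ Suc n) \<le> 1 * norm (z ^ Suc n)"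
      by (intro mult_right_mono) auto
    then show ?thesis by (simp add: norm_mult norm_power del: power_Suc)
  qed
qed

text \<open>The factor at \<open>q = 1\<close> is the limit \<open>k\<close> of \<open>(1 - q^k) / (1 - q)\<close>.\<close>

definition q_fact :: "real \<Rightarrow> nat \<Rightarrow> real" where
  "q_fact q n = (\<Prod>k=1..n. if q = 1 then real k else (1 - q ^ k) / (1 - q))"

lemma q_fact_1: "q_fact 1 n = fact n"
  by (simp add: q_fact_def fact_prod)

lemma q_fact_ge_1:
  assumes "q > 0"
  shows "q_fact q n \<ge> 1"
  unfolding q_fact_def
proof (rule prod_ge_1)
  fix k assume k: "k \<in> {1..n}"
  show "1 \<le> (if q = 1 then real k else (1 - q ^ k) / (1 - q))"
  proof (cases "q = 1")
    case True
    with k show ?thesis by simp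
  next
    case False
    from k obtain m where m: "k = Suc m" by (cases k) auto
    have "(1 - q ^ k) / (1 - q) = (\<Sum>i<k. q ^ i)"
      using False sum_gp_strict[of q k] by simp
    also have "\<dots> = 1 + (\<Sum>i<m. q ^ Suc i)"
      unfolding m by (subst sum.lessThan_Suc_shift) simp
    also have "\<dots> \<ge> 1" using assms by (simp add: sum_nonneg)
    finally show ?thesis using False by simp
  qed
qed

definition q_cos :: "real \<Rightarrow> complex \<Rightarrow> complex" where
  "q_cos q z = (\<Sum>n. (- 1) ^ n * z ^ (2 * n) / complex_of_real (q_fact q (2 * n)))"

definition q_sin :: "real \<Rightarrow> complex \<Rightarrow> complex" where
  "q_sin q z = (\<Sum>n. (- 1) ^ n * z ^ (2 * n + 1) / complex_of_real (q_fact q (2 * n + 1)))"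

lemma norm_div_q_fact_le:
  assumes "q > 0"
  shows "norm ((- 1) ^ n * w / complex_of_real (q_fact q m)) \<le> norm w"
proof -
  have 1: "q_fact q m \<ge> 1" using q_fact_ge_1[OF assms] .
  then have "norm w / q_fact q m \<le> norm w / 1" by (intro divide_left_mono) auto
  with 1 show ?thesis by (simp add: norm_divide norm_mult norm_power)
qed

lemma summable_norm_sq_power:
  fixes z :: complex
  assumes "norm z < 1"
  shows "summable (\<lambda>n. norm (z ^ (2 * n)))"
  using assms summable_geometric[of "(norm z)\<^sup>2"]
  by (simp add: norm_power power_mult power_less_one_iff abs_square_less_1)

lemma summable_q_cos:
  assumes "q > 0" "norm z < 1"
  shows "summable (\<lambda>n. (- 1) ^ n * z ^ (2 * n) / complex_of_real (q_fact q (2 * n)))"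
  by (rule summable_comparison_test'[OF summable_norm_sq_power[OF assms(2)]])
     (rule norm_div_q_fact_le[OF assms(1)])

lemma summable_q_sin:
  assumes "q > 0" "norm z < 1"
  shows "summable (\<lambda>n. (- 1) ^ n * z ^ (2 * n + 1) / complex_of_real (q_fact q (2 * n + 1)))"
proof (rule summable_comparison_test')
  show "summable (\<lambda>n. norm (z ^ (2 * n + 1)))"
    using summable_mult[OF summable_norm_sq_power[OF assms(2)], of "norm z"]
    by (simp add: norm_mult)
qed (rule norm_div_q_fact_le[OF assms(1)])

definition q_cos_fps :: "real \<Rightarrow> real fps" where
  "q_cos_fps q = Abs_fps (\<lambda>n. if even n then (- 1) ^ (n div 2) / q_fact q n else 0)"

definition q_sin_fps :: "real \<Rightarrow> real fps" where
  "q_sin_fps q = Abs_fps (\<lambda>n. if odd n then (- 1) ^ (n div 2) / q_fact q n else 0)"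

definition q_zigzag :: "real \<Rightarrow> nat \<Rightarrow> real" where
  "q_zigzag q n = q_fact q n * fps_nth (1 / q_cos_fps q + q_sin_fps q / q_cos_fps q - 1) n"

lemma q_zigzag_fps:
  assumes "q > 0"
  shows "Abs_fps (\<lambda>n. if n = 0 then 0 else q_zigzag q n / q_fact q n)
         = 1 / q_cos_fps q + q_sin_fps q / q_cos_fps q - 1"
proof (rule fps_ext)
  fix n
  have c0: "fps_nth (q_cos_fps q) 0 = 1" by (simp add: q_cos_fps_def q_fact_def)
  have s0: "fps_nth (q_sin_fps q) 0 = 0" by (simp add: q_sin_fps_def)
  have "q_fact q n \<noteq> 0" using q_fact_ge_1[OF assms, of n] by auto
  then show "fps_nth (Abs_fps (\<lambda>n. if n = 0 then 0 else q_zigzag q n / q_fact q n)) n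
      = fps_nth (1 / q_cos_fps q + q_sin_fps q / q_cos_fps q - 1) n"
    using c0 s0 by (auto simp: q_zigzag_def fps_divide_unit)
qed

text \<open>\<open>j\<close> runs over functions on \<open>{1..r}\<close>, i.e. tuples \<open>(j 1, \<dots>, j r)\<close>.\<close>

definition odd_compositions :: "nat \<Rightarrow> nat \<Rightarrow> (nat \<Rightarrow> nat) set" where
  "odd_compositions r m =
     {j \<in> {1..r} \<rightarrow>\<^sub>E {i. 1 \<le> i \<and> odd i}. (\<Sum>k=1..r. j k) = m}"

lemma finite_odd_compositions: "finite (odd_compositions r m)"
proof (rule finite_subset)
  show "odd_compositions r m \<subseteq> {1..r} \<rightarrow>\<^sub>E {..m}"
  proof
    fix j assume "j \<in> odd_compositions r m"
    then have j: "j \<in> extensional {1..r}" "(\<Sum>k=1..r. j k) = m"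
      by (auto simp: odd_compositions_def PiE_def)
    have "j k \<le> m" if "k \<in> {1..r}" for k
      using member_le_sum[OF that, of j] j(2) by simp
    with j(1) show "j \<in> {1..r} \<rightarrow>\<^sub>E {..m}" by (auto simp: PiE_def)
  qed
  show "finite ({1..r} \<rightarrow>\<^sub>E {..m})" by (intro finite_PiE) auto
qed

text \<open>The value at \<open>z\<close> of an expression that is understood by continuity at \<open>0\<close>:
  at \<open>z = 0\<close> the value assigned by division by zero is disregarded.\<close>

definition has_value_cont0 :: "(complex \<Rightarrow> complex) \<Rightarrow> complex \<Rightarrow> complex \<Rightarrow> bool" where
  "has_value_cont0 f z v \<longleftrightarrow> (if z = 0 then (f \<longlongrightarrow> v) (at 0) else f z = v)"

text \<open>Only meaningful for \<open>0 < \<xi> < 1\<close>.\<close>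

definition persistence_gf_formula :: "real \<Rightarrow> real \<Rightarrow> complex \<Rightarrow> complex" where
  "persistence_gf_formula \<theta> \<xi> z =
     (let a = complex_of_real (sqrt (\<xi> * (1 - \<xi>))) in
        1 / (z * a) *
        (q_sin (- \<theta>) (a * z) /
         (q_cos (- \<theta>) (a * z) - complex_of_real (sqrt ((1 - \<xi>) / \<xi>)) * q_sin (- \<theta>) (a * z))) - 1)"

end

theory Submission
  imports Defs
begin

text \<open>
  Put \<open>q = - \<theta> > 0\<close>. From a positive state \<open>x\<close> every step is allowed except one to a point below
  \<open>- q x\<close>; from a negative state only a step to a point above \<open>q \<bar>x\<bar>\<close> is allowed. Writing the first kind of
  step as ``free step minus forbidden step'' leaves only steps that change sign and satisfy
  \<open>\<bar>y\<bar> > q \<bar>x\<bar>\<close>. A chain of \<open>k\<close> such steps started at modulus \<open>x\<close> integrates against the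
  exponential density to \<open>exp (- q (1 + \<dots> + q^(k-1)) x) / [k]_q!\<close>, so the persistence probability
  from a given starting point is an explicit combination of these weights. Integrating over the
  starting point gives a convolution identity, which says that the generating function times
  \<open>cos_q - sqrt ((1-\<xi>)/\<xi>) sin_q\<close> equals \<open>sin_q\<close>, up to scaling. Both the closed form and, by
  expanding \<open>T / (1 - b T)\<close> with \<open>T = sin_q / cos_q\<close>, the coefficient formula follow from this.
  The symmetry \<open>\<theta> \<mapsto> 1 / \<theta>\<close> is time reversal.
\<close>

subsection \<open>Iterated integrals\<close>

text \<open>The probability that \<open>n\<close> further steps from the current state
  \<open>x\<close> all satisfy the constraint, obtained by conditioning on the first of
  them.\<close>

fun persist_from :: "real measure \<Rightarrow> real \<Rightarrow> nat \<Rightarrow> real \<Rightarrow> real" where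
  "persist_from \<nu> \<theta> 0 = (\<lambda>x. 1)"
| "persist_from \<nu> \<theta> (Suc n) =
     (\<lambda>x. \<integral>y. (if \<theta> * x < y then persist_from \<nu> \<theta> n y else 0) \<partial>\<nu>)"

lemma borel_measurable_persist_from:
  assumes "prob_space \<nu>" and [measurable_cong]: "sets \<nu> = sets borel"
  shows "persist_from \<nu> \<theta> n \<in> borel_measurable borel"
proof (induction n)
  case (Suc n)
  interpret prob_space \<nu> by fact
  have [measurable]: "persist_from \<nu> \<theta> n \<in> borel_measurable borel" by fact
  show ?case by simp measurable
qed simp

lemma persist_from_bounds:
  assumes "prob_space \<nu>" and "sets \<nu> = sets borel"
  shows "0 \<le> persist_from \<nu> \<theta> n x \<and> persist_from \<nu> \<theta> n x \<le> 1"
proof (induction n arbitrary: x)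
  case (Suc n)
  interpret prob_space \<nu> by fact
  note [measurable_cong] = assms(2)
  note [measurable] = borel_measurable_persist_from[OF assms]
  have "integrable \<nu> (\<lambda>y. if \<theta> * x < y then persist_from \<nu> \<theta> n y else 0)"
    using Suc by (intro integrable_const_bound[where B=1]) auto
  then show ?case
    using Suc by (auto intro!: integral_nonneg_AE integral_le_const)
qed simp

text \<open>Integrating out the last coordinate turns \<open>m\<close> remaining steps seen from
  \<open>\<omega> (Suc n)\<close> into \<open>Suc m\<close> remaining steps seen from
  \<open>\<omega> n\<close>. The spare parameter \<open>m\<close> carries the induction;
  \<open>m = 0\<close> gives the probability of the event.\<close>

lemma integral_persist_from_PiM:
  assumes \<nu>: "prob_space \<nu>" and s: "sets \<nu> = sets borel"
  shows "(\<integral>\<omega>. (if \<forall>i\<in>{1..n}. \<theta> * \<omega> (i - 1) < \<omega> i then persist_from \<nu> \<theta> m (\<omega> n) else 0)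
            \<partial>PiM {..n} (\<lambda>_. \<nu>))
         = (\<integral>x. persist_from \<nu> \<theta> (m + n) x \<partial>\<nu>)"
proof (induction n arbitrary: m)
  case 0
  interpret prob_space \<nu> by fact
  interpret product_prob_space "\<lambda>_. \<nu>" "{..0::nat}" by unfold_locales
  note [measurable_cong] = s
  note [measurable] = borel_measurable_persist_from[OF assms]
  show ?case
    using product_integral_singleton[of "persist_from \<nu> \<theta> m" "0::nat"] by simp
next
  case (Suc n)
  interpret prob_space \<nu> by fact
  interpret product_prob_space "\<lambda>_. \<nu>" "{..Suc n}" by unfold_locales
  note [measurable_cong] = s
  note [measurable] = borel_measurable_persist_from[OF assms]
  let ?A = "\<lambda>n \<omega>. \<forall>i\<in>{1..n}. \<theta> * \<omega> (i - 1) < \<omega> i"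
  let ?g = "\<lambda>\<omega>. if ?A (Suc n) \<omega> then persist_from \<nu> \<theta> m (\<omega> (Suc n)) else 0"
  have ins: "{..Suc n} = insert (Suc n) {..n}" by auto
  have int: "integrable (PiM (insert (Suc n) {..n}) (\<lambda>_. \<nu>)) ?g"
  proof (rule finite_measure.integrable_const_bound[where B=1])
    show "finite_measure (PiM (insert (Suc n) {..n}) (\<lambda>_. \<nu>))"
      by (intro prob_space.finite_measure prob_space_PiM \<nu>)
    show "?g \<in> borel_measurable (PiM (insert (Suc n) {..n}) (\<lambda>_. \<nu>))"
      unfolding ins[symmetric] by measurable auto
  qed (use persist_from_bounds[OF assms] in auto)
  have "integral\<^sup>L (PiM {..Suc n} (\<lambda>_. \<nu>)) ?g
      = (\<integral>\<omega>. (\<integral>y. ?g (fun_upd \<omega> (Suc n) y) \<partial>\<nu>) \<partial>PiM {..n} (\<lambda>_. \<nu>))"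
    unfolding ins using int by (intro product_integral_insert) auto
  also have "\<dots> = (\<integral>\<omega>. (if ?A n \<omega> then persist_from \<nu> \<theta> (Suc m) (\<omega> n) else 0)
                     \<partial>PiM {..n} (\<lambda>_. \<nu>))"
  proof (intro Bochner_Integration.integral_cong refl)
    fix \<omega> :: "nat \<Rightarrow> real"
    have A: "?A (Suc n) (fun_upd \<omega> (Suc n) y) \<longleftrightarrow> ?A n \<omega> \<and> \<theta> * \<omega> n < y" for y
    proof -
      have "?A (Suc n) \<omega>' \<longleftrightarrow> ?A n \<omega>' \<and> \<theta> * \<omega>' n < \<omega>' (Suc n)" for \<omega>' :: "nat \<Rightarrow> real"
        by (auto simp: atLeastAtMostSuc_conv)
      moreover have "?A n (fun_upd \<omega> (Suc n) y) \<longleftrightarrow> ?A n \<omega>"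
        by (intro ball_cong) auto
      moreover have "fun_upd \<omega> (Suc n) y n = \<omega> n" by simp
      ultimately show ?thesis by (simp only: fun_upd_same)
    qed
    have if_conj: "(\<integral>y. (if P \<and> Q y then h y else 0) \<partial>\<nu>) =
        (if P then \<integral>y. (if Q y then h y else 0) \<partial>\<nu> else 0)" for P Q and h :: "real \<Rightarrow> real"
      by (cases P) simp_all
    show "(\<integral>y. ?g (fun_upd \<omega> (Suc n) y) \<partial>\<nu>) =
        (if ?A n \<omega> then persist_from \<nu> \<theta> (Suc m) (\<omega> n) else 0)"
      by (simp only: A if_conj fun_upd_same persist_from.simps)
  qed
  also have "\<dots> = (\<integral>x. persist_from \<nu> \<theta> (m + Suc n) x \<partial>\<nu>)"
    using Suc.IH[of "Suc m"] by simp
  finally show ?case .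
qed

section \<open>Reduction to product measures, and time reversal\<close>

text \<open>Independence makes the joint law a product measure. Working on \<open>{..n}\<close> only
  lets this apply to a path reversed at time \<open>n\<close> as well.\<close>

lemma (in prob_space) persistence_prob_eq_PiM:
  fixes X :: "nat \<Rightarrow> 'a \<Rightarrow> real"
  assumes ind: "indep_vars (\<lambda>_. borel) X {..n}" and d: "\<And>i. i \<le> n \<Longrightarrow> distr M borel (X i) = \<nu>"
  shows "persistence_prob M X \<theta> n =
    measure (PiM {..n} (\<lambda>_. \<nu>))
      {\<omega> \<in> space (PiM {..n} (\<lambda>_. \<nu>)). \<forall>i\<in>{1..n}. \<omega> i > \<theta> * \<omega> (i - 1)}"
proof -
  have rv [measurable]: "random_variable borel (X i)" if "i \<in> {..n}" for i
    using ind that by (auto simp: indep_vars_def)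
  have [measurable_cong]: "sets \<nu> = sets borel"
    using d[of 0] by auto
  have "distr M (PiM {..n} (\<lambda>i. borel)) (\<lambda>x. \<lambda>i\<in>{..n}. X i x) = PiM {..n} (\<lambda>i. distr M borel (X i))"
    by (rule iffD1[OF indep_vars_iff_distr_eq_PiM']) (use ind rv in auto)
  also have "\<dots> = PiM {..n} (\<lambda>_. \<nu>)"
    by (intro PiM_cong) (auto simp: d)
  finally have D: "PiM {..n} (\<lambda>_. \<nu>) = distr M (PiM {..n} (\<lambda>i. borel)) (\<lambda>x. \<lambda>i\<in>{..n}. X i x)" ..
  have [measurable]: "(\<lambda>x. \<lambda>i\<in>{..n}. X i x) \<in> M \<rightarrow>\<^sub>M PiM {..n} (\<lambda>i. borel)"
    by (intro measurable_restrict rv)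
  have pred: "{\<omega> \<in> space (PiM {..n} (\<lambda>i. borel)). \<forall>i\<in>{1..n}. \<omega> i > \<theta> * \<omega> (i - 1)}
         \<in> sets (PiM {..n} (\<lambda>i. borel :: real measure))"
    by measurable auto
  have "(\<lambda>i\<in>{..n}. X i x) \<in> space (PiM {..n} (\<lambda>i. borel))" for x
    by (simp add: space_PiM)
  then have "(\<lambda>x. \<lambda>i\<in>{..n}. X i x) -` {\<omega> \<in> space (PiM {..n} (\<lambda>i. borel)). \<forall>i\<in>{1..n}. \<omega> i > \<theta> * \<omega> (i - 1)}
      \<inter> space M = {x \<in> space M. \<forall>i\<in>{1..n}. X i x > \<theta> * X (i - 1) x}"
    by auto
  then show ?thesis
    unfolding D persistence_prob_def using pred by (subst measure_distr) simp_all
qed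

lemma (in prob_space) persistence_prob_eq_integral:
  fixes X :: "nat \<Rightarrow> 'a \<Rightarrow> real"
  assumes ind: "indep_vars (\<lambda>_. borel) X UNIV" and d: "\<And>i. distr M borel (X i) = \<nu>"
  shows "persistence_prob M X \<theta> n = (\<integral>x. persist_from \<nu> \<theta> n x \<partial>\<nu>)"
proof -
  have s [measurable_cong]: "sets \<nu> = sets borel" using d[of 0] by auto
  have p: "prob_space \<nu>"
    using prob_space_distr[of "X 0" borel] ind d[of 0] by (auto simp: indep_vars_def)
  let ?P = "PiM {..n} (\<lambda>_. \<nu>)"
  interpret P: prob_space ?P by (intro prob_space_PiM p)
  have [measurable]: "{\<omega> \<in> space ?P. \<forall>i\<in>{1..n}. \<omega> i > \<theta> * \<omega> (i - 1)} \<in> sets ?P"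
    by measurable auto
  have "persistence_prob M X \<theta> n = measure ?P {\<omega> \<in> space ?P. \<forall>i\<in>{1..n}. \<omega> i > \<theta> * \<omega> (i - 1)}"
    by (rule persistence_prob_eq_PiM) (auto intro: indep_vars_subset[OF ind] d)
  also have "\<dots> = (\<integral>\<omega>. indicator {\<omega> \<in> space ?P. \<forall>i\<in>{1..n}. \<omega> i > \<theta> * \<omega> (i - 1)} \<omega> \<partial>?P)"
    by (subst Bochner_Integration.integral_indicator) (auto intro!: arg_cong[where f="measure ?P"])
  also have "\<dots> = (\<integral>\<omega>. (if \<forall>i\<in>{1..n}. \<theta> * \<omega> (i - 1) < \<omega> i then persist_from \<nu> \<theta> 0 (\<omega> n) else 0) \<partial>?P)"
    by (intro Bochner_Integration.integral_cong) (auto simp: indicator_def)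
  finally show ?thesis
    using integral_persist_from_PiM[OF p s, where m=0] by simp
qed

text \<open>The reversed path has the same joint law as the original one, and dividing
  \<open>X (i - 1) > \<theta> * X i\<close> by the negative \<open>\<theta>\<close> turns it into
  \<open>X i > 1 / \<theta> * X (i - 1)\<close>.\<close>

lemma (in prob_space) persistence_prob_inverse:
  fixes X :: "nat \<Rightarrow> 'a \<Rightarrow> real"
  assumes ind: "indep_vars (\<lambda>_. borel) X UNIV" and d: "\<And>i. distr M borel (X i) = \<nu>"
    and "\<theta> < 0"
  shows "persistence_prob M X \<theta> n = persistence_prob M X (1 / \<theta>) n"
proof -
  \<comment> \<open>Subtraction is truncated, so \<open>Y i = X 0\<close> for all
    \<open>i \<ge> n\<close>; independence is therefore claimed on \<open>{..n}\<close>
    only.\<close>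
  define Y where "Y i = X (n - i)" for i
  have "indep_vars (\<lambda>_. borel) Y {..n}"
    unfolding indep_vars_def2 indep_sets_def
  proof (intro conjI ballI allI impI)
    fix i show "random_variable borel (Y i)"
      using ind by (auto simp: indep_vars_def Y_def)
  next
    fix i show "{Y i -` A \<inter> space M |A. A \<in> sets borel} \<subseteq> events"
      using ind by (auto simp: indep_vars_def Y_def intro!: measurable_sets)
  next
    fix J A
    assume J: "J \<subseteq> {..n}" "J \<noteq> {}" "finite J"
      and A: "A \<in> (\<Pi> j\<in>J. {Y j -` B \<inter> space M |B. B \<in> sets borel})"
    let ?r = "\<lambda>i. n - i"
    have rr: "?r (?r i) = i" if "i \<in> J" for i using J that by auto
    then have inj: "inj_on ?r J" by (metis inj_onI)
    \<comment> \<open>Reflection is an involution on \<open>{..n}\<close>, so independence of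
      \<open>Y\<close> along \<open>J\<close> is that of \<open>X\<close> along the reflected index
      set.\<close>
    have "indep_sets (\<lambda>i. {X i -` B \<inter> space M |B. B \<in> sets borel}) UNIV"
      using ind by (simp add: indep_vars_def2)
    then have "prob (\<Inter>j\<in>?r ` J. A (?r j)) = (\<Prod>j\<in>?r ` J. prob (A (?r j)))"
      by (rule indep_setsD) (use J A rr in \<open>auto simp: Y_def\<close>)
    then show "prob (\<Inter>j\<in>J. A j) = (\<Prod>j\<in>J. prob (A j))"
      using rr inj by (simp add: prod.reindex cong: INF_cong)
  qed
  then have "persistence_prob M Y \<theta> n = persistence_prob M X \<theta> n"
    using d indep_vars_subset[OF ind]
    by (subst (1 2) persistence_prob_eq_PiM[where \<nu>=\<nu>]) (auto simp: Y_def)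
  moreover have "(\<forall>i\<in>{1..n}. Y i \<omega> > \<theta> * Y (i - 1) \<omega>) \<longleftrightarrow>
      (\<forall>i\<in>{1..n}. X i \<omega> > 1 / \<theta> * X (i - 1) \<omega>)" for \<omega>
  proof -
    \<comment> \<open>Substituting \<open>Suc n - i\<close> for \<open>i\<close> turns
      \<open>Y i\<close> and \<open>Y (i - 1)\<close> into \<open>X (i - 1)\<close> and
      \<open>X i\<close>.\<close>
    have "(\<forall>i\<in>{1..n}. Y i \<omega> > \<theta> * Y (i - 1) \<omega>) \<longleftrightarrow>
        (\<forall>i\<in>(\<lambda>i. Suc n - i) ` {1..n}. X (i - 1) \<omega> > \<theta> * X i \<omega>)"
      by (auto simp: Y_def Suc_diff_le)
    also have "(\<lambda>i. Suc n - i) ` {1..n} = {1..n}"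
    proof (intro equalityI subsetI)
      fix i assume "i \<in> {1..n}"
      then show "i \<in> (\<lambda>i. Suc n - i) ` {1..n}" by (intro image_eqI[of _ _ "Suc n - i"]) auto
    qed auto
    also have "(\<lambda>i. X (i - 1) \<omega> > \<theta> * X i \<omega>) = (\<lambda>i. X i \<omega> > 1 / \<theta> * X (i - 1) \<omega>)"
      using \<open>\<theta> < 0\<close> by (auto simp: field_simps)
    finally show ?thesis .
  qed
  ultimately show ?thesis by (simp add: persistence_prob_def)
qed

subsection \<open>Two-sided exponential densities\<close>

text \<open>The q-integer, written as a geometric sum so that \<open>q = 1\<close> is no separate
  case.\<close>

definition q_int :: "real \<Rightarrow> nat \<Rightarrow> real" where
  "q_int q n = (\<Sum>i<n. q ^ i)"

lemma q_int_Suc: "q_int q (Suc n) = 1 + q * q_int q n"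
  unfolding q_int_def by (subst sum.lessThan_Suc_shift) (simp add: sum_distrib_left)

lemma q_int_nonneg: "0 < q \<Longrightarrow> 0 \<le> q_int q n"
  by (simp add: q_int_def sum_nonneg)

lemma q_fact_Suc: "q_fact q (Suc n) = q_int q (Suc n) * q_fact q n"
proof (cases "q = 1")
  case False
  then have "(1 - q ^ Suc n) / (1 - q) = q_int q (Suc n)"
    unfolding q_int_def using sum_gp_strict[of q "Suc n"] by simp
  then show ?thesis using False by (simp add: q_fact_def mult.commute)
qed (simp add: q_fact_def q_int_def)

text \<open>\<open>chain_weight q k x\<close> is the probability that \<open>Y\<^sub>1 > q x\<close>, \<open>Y\<^sub>2 > q Y\<^sub>1\<close>, \<dots>, \<open>Y\<^sub>k > q Y\<^bsub>k-1\<^esub>\<close>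
  for independent standard exponential \<open>Y\<^sub>i\<close>.\<close>

definition chain_weight :: "real \<Rightarrow> nat \<Rightarrow> real \<Rightarrow> real" where
  "chain_weight q k x = exp (- (q * q_int q k * x)) / q_fact q k"

text \<open>The integral of \<open>exp (- y) * chain_weight q k y\<close> over \<open>y > c\<close>.
  At \<open>c = q * x\<close> it is the next chain weight, so the span of these weights is stable
  under one sign-changing step.\<close>

definition chain_tail :: "real \<Rightarrow> nat \<Rightarrow> real \<Rightarrow> real" where
  "chain_tail q k c = exp (- (q_int q (Suc k) * c)) / q_fact q (Suc k)"

lemma chain_tail_mult: "chain_tail q k (q * x) = chain_weight q (Suc k) x"
  by (simp add: chain_tail_def chain_weight_def mult_ac)

lemma chain_tail_0: "chain_tail q k 0 = 1 / q_fact q (Suc k)"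
  by (simp add: chain_tail_def)

lemma chain_weight_0: "chain_weight q 0 x = 1"
  by (simp add: chain_weight_def q_int_def q_fact_def)

text \<open>The integrand is \<open>exp (- l * y) / q_fact q k\<close>, whose rate
  \<open>l = 1 + q * q_int q k\<close> is the next q-integer; the factor \<open>1 / l\<close> from
  the antiderivative extends the q-factorial by one.\<close>

lemma has_bochner_integral_chain_weight:
  assumes "q > 0"
  shows "has_bochner_integral lborel
    (\<lambda>y. if c < y then exp (- y) * chain_weight q k y else 0) (chain_tail q k c)"
proof (rule has_bochner_integral_nn_integral)
  let ?f = "\<lambda>y. exp (- y) * chain_weight q k y"
  define l where "l = q_int q (Suc k)"
  have l: "l = 1 + q * q_int q k" "l > 0"
    using q_int_nonneg[OF assms, of k] assms by (auto simp: l_def q_int_Suc add_pos_nonneg)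
  have fq: "q_fact q n > 0" for n using q_fact_ge_1[OF assms, of n] by simp
  have f_eq: "?f y = exp (- l * y) / q_fact q k" for y
    by (simp add: chain_weight_def l(1) algebra_simps flip: exp_add)
  have nn: "0 \<le> ?f y" for y using fq[of k] by (simp add: chain_weight_def)
  have [measurable]: "?f \<in> borel_measurable borel"
    unfolding chain_weight_def by measurable
  show "(\<lambda>y. if c < y then ?f y else 0) \<in> borel_measurable lborel" by simp
  show "AE y in lborel. 0 \<le> (if c < y then ?f y else 0)" using nn by simp
  show "0 \<le> chain_tail q k c" using fq[of "Suc k"] by (simp add: chain_tail_def)
  \<comment> \<open>The fundamental theorem is applied on the closed half-line; the endpoint
    \<open>c\<close> is a null set.\<close>
  have "(\<integral>\<^sup>+y. ennreal (if c < y then ?f y else 0) \<partial>lborel)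
      = (\<integral>\<^sup>+y. ennreal (?f y) * indicator {c..} y \<partial>lborel)"
  proof (rule nn_integral_cong_AE)
    show "AE y in lborel. ennreal (if c < y then ?f y else 0) = ennreal (?f y) * indicator {c..} y"
      using AE_lborel_singleton[of c] by eventually_elim (auto simp: indicator_def)
  qed
  also have "\<dots> = ennreal (0 - (- exp (- l * c) / (l * q_fact q k)))"
  proof (rule nn_integral_FTC_atLeast[where F = "\<lambda>y. - exp (- l * y) / (l * q_fact q k)"])
    show "((\<lambda>y. - exp (- l * y) / (l * q_fact q k)) has_real_derivative ?f y) (at y)" for y
      unfolding f_eq using l(2) fq[of k]
      by (auto intro!: derivative_eq_intros simp: field_simps)
    have "filterlim (\<lambda>y. - l * y) at_bot at_top"
      using l(2) by real_asymp
    then have "((\<lambda>y. exp (- l * y)) \<longlongrightarrow> 0) at_top"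
      by (rule filterlim_compose[OF exp_at_bot])
    then have "((\<lambda>y. - exp (- l * y) / (l * q_fact q k)) \<longlongrightarrow> - 0 / (l * q_fact q k)) at_top"
      by (intro tendsto_intros) (use l(2) fq[of k] in auto)
    then show "((\<lambda>y. - exp (- l * y) / (l * q_fact q k)) \<longlongrightarrow> 0) at_top" by simp
  qed (use nn in auto)
  also have "0 - (- exp (- l * c) / (l * q_fact q k)) = chain_tail q k c"
    by (simp add: chain_tail_def q_fact_Suc l_def)
  finally show "(\<integral>\<^sup>+y. ennreal (if c < y then ?f y else 0) \<partial>lborel) = ennreal (chain_tail q k c)" .
qed

abbreviation two_sided_exp :: "real \<Rightarrow> real measure" where
  "two_sided_exp \<xi> \<equiv> density lborel (\<lambda>x. ennreal (two_sided_exp_density \<xi> x))"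

lemma borel_measurable_two_sided_exp_density [measurable]:
  "two_sided_exp_density \<xi> \<in> borel_measurable borel"
  unfolding two_sided_exp_density_def by measurable

lemma two_sided_exp_density_nonneg: "0 \<le> \<xi> \<Longrightarrow> \<xi> \<le> 1 \<Longrightarrow> 0 \<le> two_sided_exp_density \<xi> x"
  by (simp add: two_sided_exp_density_def)

text \<open>As \<open>c\<close> is nonnegative, the half-line meets only the branch
  \<open>(1 - \<xi>) * exp (- y)\<close> of the density, and the chain-weight integral extends by
  linearity.\<close>

lemma has_bochner_integral_upper_tail:
  assumes "q > 0" "0 \<le> \<xi>" "\<xi> \<le> 1" "0 \<le> c" and [measurable]: "g \<in> borel_measurable borel"
    and g: "\<And>y. y > 0 \<Longrightarrow> g y = (\<Sum>k\<in>I. a k * chain_weight q k y)"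
  shows "has_bochner_integral (two_sided_exp \<xi>) (\<lambda>y. if c < y then g y else 0)
           ((1 - \<xi>) * (\<Sum>k\<in>I. a k * chain_tail q k c))"
proof (rule has_bochner_integral_density)
  have "has_bochner_integral lborel
      (\<lambda>y. (1 - \<xi>) * (\<Sum>k\<in>I. a k * (if c < y then exp (- y) * chain_weight q k y else 0)))
      ((1 - \<xi>) * (\<Sum>k\<in>I. a k * chain_tail q k c))"
    by (intro has_bochner_integral_mult_right has_bochner_integral_sum
        has_bochner_integral_chain_weight assms)
  also have "(\<lambda>y. (1 - \<xi>) * (\<Sum>k\<in>I. a k * (if c < y then exp (- y) * chain_weight q k y else 0)))
      = (\<lambda>y. two_sided_exp_density \<xi> y *\<^sub>R (if c < y then g y else 0))"
    using \<open>0 \<le> c\<close> g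
    by (auto simp: fun_eq_iff two_sided_exp_density_def sum_distrib_left mult_ac)
  finally show "has_bochner_integral lborel
      (\<lambda>y. two_sided_exp_density \<xi> y *\<^sub>R (if c < y then g y else 0))
      ((1 - \<xi>) * (\<Sum>k\<in>I. a k * chain_tail q k c))" .
qed (use assms two_sided_exp_density_nonneg in auto)

lemma has_bochner_integral_lower_tail:
  assumes "q > 0" "0 \<le> \<xi>" "\<xi> \<le> 1" "0 \<le> c" and [measurable]: "g \<in> borel_measurable borel"
    and g: "\<And>y. y > 0 \<Longrightarrow> g (- y) = (\<Sum>k\<in>I. a k * chain_weight q k y)"
  shows "has_bochner_integral (two_sided_exp \<xi>) (\<lambda>y. if y < - c then g y else 0)
           (\<xi> * (\<Sum>k\<in>I. a k * chain_tail q k c))"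
proof (rule has_bochner_integral_density)
  have "has_bochner_integral lborel
      (\<lambda>y. \<xi> * (\<Sum>k\<in>I. a k * (if c < y then exp (- y) * chain_weight q k y else 0)))
      (\<xi> * (\<Sum>k\<in>I. a k * chain_tail q k c))"
    by (intro has_bochner_integral_mult_right has_bochner_integral_sum
        has_bochner_integral_chain_weight assms)
  \<comment> \<open>The shape \<open>0 + (-1) * y\<close> is that of the affine substitution which
    reflects the lower tail to \<open>y > c\<close>.\<close>
  also have "(\<lambda>y. \<xi> * (\<Sum>k\<in>I. a k * (if c < y then exp (- y) * chain_weight q k y else 0)))
      = (\<lambda>y. two_sided_exp_density \<xi> (0 + (-1) * y) *\<^sub>R
           (if 0 + (-1) * y < - c then g (0 + (-1) * y) else 0))"
    using \<open>0 \<le> c\<close> g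
    by (auto simp: fun_eq_iff two_sided_exp_density_def sum_distrib_left mult_ac)
  finally show "has_bochner_integral lborel
      (\<lambda>y. two_sided_exp_density \<xi> y *\<^sub>R (if y < - c then g y else 0))
      (\<xi> * (\<Sum>k\<in>I. a k * chain_tail q k c))"
    by (subst lborel_has_bochner_integral_real_affine_iff[where c = "-1" and t = 0]) simp_all
qed (use assms two_sided_exp_density_nonneg in auto)

lemma AE_two_sided_exp_neq: "AE y in two_sided_exp \<xi>. y \<noteq> c"
proof -
  have "AE y in lborel. 0 < ennreal (two_sided_exp_density \<xi> y) \<longrightarrow> y \<noteq> c"
    using AE_lborel_singleton[of c] by eventually_elim simp
  then show ?thesis by (subst AE_density) auto
qed

lemma has_bochner_integral_two_sided_exp:
  assumes "q > 0" "0 \<le> \<xi>" "\<xi> \<le> 1" and [measurable]: "g \<in> borel_measurable borel"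
    and g: "\<And>y. y > 0 \<Longrightarrow> g y = (\<Sum>k\<in>I. a k * chain_weight q k y)"
           "\<And>y. y > 0 \<Longrightarrow> g (- y) = (\<Sum>k\<in>I. b k * chain_weight q k y)"
  shows "has_bochner_integral (two_sided_exp \<xi>) g
           (\<Sum>k\<in>I. ((1 - \<xi>) * a k + \<xi> * b k) / q_fact q (Suc k))"
proof -
  have "has_bochner_integral (two_sided_exp \<xi>)
      (\<lambda>y. (if 0 < y then g y else 0) + (if y < - 0 then g y else 0))
      ((1 - \<xi>) * (\<Sum>k\<in>I. a k * chain_tail q k 0) + \<xi> * (\<Sum>k\<in>I. b k * chain_tail q k 0))"
    using assms
    by (intro has_bochner_integral_add has_bochner_integral_upper_tail has_bochner_integral_lower_tail) auto
  moreover have AE: "AE y in two_sided_exp \<xi>. (if 0 < y then g y else 0) + (if y < - 0 then g y else 0) = g y"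
    using AE_two_sided_exp_neq[where \<xi>=\<xi> and c=0] by eventually_elim auto
  ultimately have "has_bochner_integral (two_sided_exp \<xi>) g
      ((1 - \<xi>) * (\<Sum>k\<in>I. a k * chain_tail q k 0) + \<xi> * (\<Sum>k\<in>I. b k * chain_tail q k 0))"
    using has_bochner_integral_cong_AE[OF _ _ AE] by simp
  then show ?thesis
    by (simp add: chain_tail_0 sum_distrib_left sum.distrib add_divide_distrib distrib_right)
qed

section \<open>Expansion in chain weights and the convolution identity\<close>

text \<open>A sign-changing step carries the factor \<open>- \<xi>\<close> from a positive state (a
  forbidden step, subtracted) and \<open>1 - \<xi>\<close> from a negative one, so two of them give
  \<open>- m\<close>. The index \<open>k < n\<close> counts such steps before the first free step,
  which leaves \<open>p (n - 1 - k)\<close>. A free step starts from a positive state, hence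
  \<open>k\<close> is even in \<open>a\<close> and odd in \<open>b\<close>. For \<open>k = n\<close>
  no free step occurs.\<close>

lemma persist_from_two_sided_exp:
  fixes q \<xi> :: real
  assumes q: "q > 0" and \<xi>: "0 \<le> \<xi>" "\<xi> \<le> 1" and prob: "prob_space (two_sided_exp \<xi>)"
  defines "F \<equiv> persist_from (two_sided_exp \<xi>) (- q)"
  defines "p \<equiv> \<lambda>n. \<integral>x. F n x \<partial>two_sided_exp \<xi>"
  defines "m \<equiv> \<xi> * (1 - \<xi>)"
  defines "a \<equiv> \<lambda>n k. if k < n then p (n - 1 - k) * (if even k then (- m) ^ (k div 2) else 0)
     else (if even k then 1 else - \<xi>) * (- m) ^ (k div 2)"
  defines "b \<equiv> \<lambda>n k. if k < n then p (n - 1 - k) * (if odd k then (1 - \<xi>) * (- m) ^ (k div 2) else 0)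
     else (if even k then 1 else 1 - \<xi>) * (- m) ^ (k div 2)"
  assumes x: "x > 0"
  shows "F n x = (\<Sum>k\<le>n. a n k * chain_weight q k x) \<and> F n (- x) = (\<Sum>k\<le>n. b n k * chain_weight q k x)"
  using x
proof (induction n arbitrary: x)
  case 0
  then show ?case by (simp add: F_def a_def b_def chain_weight_0)
next
  case (Suc n)
  have [measurable]: "F n \<in> borel_measurable borel" for n
    unfolding F_def by (rule borel_measurable_persist_from) (use prob in auto)
  have F_pos: "F n y = (\<Sum>k\<in>{..n}. a n k * chain_weight q k y)"
    and F_neg: "F n (- y) = (\<Sum>k\<in>{..n}. b n k * chain_weight q k y)" if "y > 0" for y
    using Suc.IH[OF that] by auto
  have F_Suc: "F (Suc n) z = (\<integral>y. (if - q * z < y then F n y else 0) \<partial>two_sided_exp \<xi>)" for z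
    unfolding F_def by simp
  have c: "0 \<le> q * x" using q Suc.prems by simp
  have int: "integrable (two_sided_exp \<xi>) (F n)"
    using has_bochner_integral_two_sided_exp[OF q \<xi> _ F_pos F_neg] by (auto simp: has_bochner_integral_iff)
  \<comment> \<open>Prepending one sign-changing step flips the sign of the start and multiplies by
    the factor of that step.\<close>
  have ab: "a (Suc n) (Suc k) = - \<xi> * b n k" "b (Suc n) (Suc k) = (1 - \<xi>) * a n k" for k
    by (auto simp: a_def b_def m_def)
  have low: "has_bochner_integral (two_sided_exp \<xi>) (\<lambda>y. if y < - (q * x) then F n y else 0)
      (\<xi> * (\<Sum>k\<le>n. b n k * chain_tail q k (q * x)))"
    by (rule has_bochner_integral_lower_tail[OF q \<xi> c _ F_neg]) auto
  \<comment> \<open>From \<open>x > 0\<close>: free step minus forbidden step. The two integrands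
    can differ only at the null point \<open>y = - (q * x)\<close>.\<close>
  have "F (Suc n) x = (\<integral>y. F n y - (if y < - (q * x) then F n y else 0) \<partial>two_sided_exp \<xi>)"
    unfolding F_Suc
  proof (rule integral_cong_AE)
    show "AE y in two_sided_exp \<xi>.
        (if - q * x < y then F n y else 0) = F n y - (if y < - (q * x) then F n y else 0)"
      using AE_two_sided_exp_neq[where \<xi>=\<xi> and c="- (q * x)"] by eventually_elim auto
  qed auto
  also have "\<dots> = p n - \<xi> * (\<Sum>k\<le>n. b n k * chain_tail q k (q * x))"
    using int low by (simp add: has_bochner_integral_iff p_def)
  \<comment> \<open>The summand \<open>k = 0\<close> is the immediate free step:
    \<open>a (Suc n) 0 = p n\<close>.\<close>
  also have "\<dots> = (\<Sum>k\<le>Suc n. a (Suc n) k * chain_weight q k x)"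
    by (subst sum.atMost_Suc_shift)
       (simp add: ab chain_weight_0 chain_tail_mult sum_distrib_left sum_negf mult.assoc,
        simp add: a_def)
  finally have 1: "F (Suc n) x = (\<Sum>k\<le>Suc n. a (Suc n) k * chain_weight q k x)" .
  have "F (Suc n) (- x) = (1 - \<xi>) * (\<Sum>k\<le>n. a n k * chain_tail q k (q * x))"
    unfolding F_Suc using has_bochner_integral_upper_tail[OF q \<xi> c _ F_pos]
    by (simp add: has_bochner_integral_iff)
  \<comment> \<open>A negative state has no free step, so here the summand \<open>k = 0\<close>
    vanishes.\<close>
  also have "\<dots> = (\<Sum>k\<le>Suc n. b (Suc n) k * chain_weight q k x)"
    by (subst sum.atMost_Suc_shift)
       (simp add: ab chain_tail_mult sum_distrib_left mult.assoc, simp add: b_def)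
  finally show ?case using 1 by blast
qed

text \<open>The Taylor coefficients of \<open>cos_q (c z) - sqrt ((1-\<xi>)/\<xi>) sin_q (c z)\<close> with
  \<open>c = sqrt (\<xi> (1-\<xi>))\<close>, in a form that makes sense also for \<open>\<xi> \<in> {0, 1}\<close>.\<close>

definition denom_coeff :: "real \<Rightarrow> real \<Rightarrow> nat \<Rightarrow> real" where
  "denom_coeff q \<xi> j =
     (if even j then 1 else - (1 - \<xi>)) * (- (\<xi> * (1 - \<xi>))) ^ (j div 2) / q_fact q j"

text \<open>Integrating the expansion over the starting point replaces the weight \<open>k\<close>
  by \<open>1 / q_fact q (Suc k)\<close>. The terms \<open>k < n\<close> become
  \<open>- denom_coeff q \<xi> (Suc k) * p (n - Suc k)\<close> and move to the left; the term
  \<open>k = n\<close> stays on the right.\<close>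

lemma persistence_convolution:
  fixes q \<xi> :: real
  assumes q: "q > 0" and \<xi>: "0 \<le> \<xi>" "\<xi> \<le> 1" and prob: "prob_space (two_sided_exp \<xi>)"
  defines "p \<equiv> \<lambda>n. \<integral>x. persist_from (two_sided_exp \<xi>) (- q) n x \<partial>two_sided_exp \<xi>"
  shows "(\<Sum>k\<le>n. denom_coeff q \<xi> k * p (n - k)) =
    (if even n then (- (\<xi> * (1 - \<xi>))) ^ (n div 2) / q_fact q (Suc n) else 0)"
proof -
  define m where "m = \<xi> * (1 - \<xi>)"
  \<comment> \<open>The term \<open>k = n\<close>: positive and negative starts contribute
    \<open>(1 - \<xi>) + \<xi> = 1\<close> for even \<open>n\<close> and cancel for odd
    \<open>n\<close>.\<close>
  define r where "r = (if even n then (- m) ^ (n div 2) / q_fact q (Suc n) else 0)"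
  have meas: "persist_from (two_sided_exp \<xi>) (- q) n \<in> borel_measurable borel"
    by (rule borel_measurable_persist_from) (use prob in auto)
  note ex = persist_from_two_sided_exp[OF q \<xi> prob, of _ n, folded p_def m_def]
  note int = has_bochner_integral_two_sided_exp[OF q \<xi> meas ex[THEN conjunct1] ex[THEN conjunct2]]
  have "p n = (\<Sum>k\<le>n. if k < n then p (n - Suc k) * (- denom_coeff q \<xi> (Suc k)) else r)"
  proof (rule trans[OF _ sum.cong[OF refl]])
    show "p n = (\<Sum>k\<le>n. ((1 - \<xi>) * (if k < n then p (n - 1 - k) * (if even k then (- m) ^ (k div 2) else 0)
             else (if even k then 1 else - \<xi>) * (- m) ^ (k div 2)) +
           \<xi> * (if k < n then p (n - 1 - k) * (if odd k then (1 - \<xi>) * (- m) ^ (k div 2) else 0)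
             else (if even k then 1 else 1 - \<xi>) * (- m) ^ (k div 2))) / q_fact q (Suc k))"
      using has_bochner_integral_integral_eq[OF int] by (simp only: p_def)
    fix k assume "k \<in> {..n}"
    show "((1 - \<xi>) * (if k < n then p (n - 1 - k) * (if even k then (- m) ^ (k div 2) else 0)
             else (if even k then 1 else - \<xi>) * (- m) ^ (k div 2)) +
           \<xi> * (if k < n then p (n - 1 - k) * (if odd k then (1 - \<xi>) * (- m) ^ (k div 2) else 0)
             else (if even k then 1 else 1 - \<xi>) * (- m) ^ (k div 2))) / q_fact q (Suc k)
         = (if k < n then p (n - Suc k) * (- denom_coeff q \<xi> (Suc k)) else r)"
      using \<open>k \<in> {..n}\<close>
      by (auto simp: denom_coeff_def r_def m_def[symmetric] algebra_simps add_divide_distrib[symmetric])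
         (auto simp: m_def algebra_simps minus_divide_left simp del: divide_minus_left)
  qed
  also have "\<dots> = (\<Sum>k<n. p (n - Suc k) * (- denom_coeff q \<xi> (Suc k))) + r"
    by (simp flip: lessThan_Suc_atMost)
  finally have "p n = (\<Sum>k<n. p (n - Suc k) * (- denom_coeff q \<xi> (Suc k))) + r" .
  moreover have "(\<Sum>k\<le>n. denom_coeff q \<xi> k * p (n - k)) = p n + (\<Sum>k<n. denom_coeff q \<xi> (Suc k) * p (n - Suc k))"
    by (subst sum.atMost_shift) (simp add: denom_coeff_def q_fact_def)
  ultimately show ?thesis by (simp add: r_def m_def sum_negf mult.commute)
qed

subsection \<open>Generating functions\<close>

text \<open>\<open>cos_q z\<close> and \<open>sin_q z / z\<close> as functions of \<open>u = z\<^sup>2\<close>: no square root of \<open>\<xi> (1-\<xi>)\<close> is then needed,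
  and the boundary values of \<open>\<xi>\<close> are covered.\<close>

definition q_cos_half :: "real \<Rightarrow> complex \<Rightarrow> complex" where
  "q_cos_half q u = (\<Sum>n. (- 1) ^ n / complex_of_real (q_fact q (2 * n)) * u ^ n)"

definition q_sin_half :: "real \<Rightarrow> complex \<Rightarrow> complex" where
  "q_sin_half q u = (\<Sum>n. (- 1) ^ n / complex_of_real (q_fact q (2 * n + 1)) * u ^ n)"

lemma summable_norm_q_half:
  fixes f :: "nat \<Rightarrow> nat" and u :: complex
  assumes "q > 0" "norm u < 1"
  shows "summable (\<lambda>n. norm ((- 1) ^ n / complex_of_real (q_fact q (f n)) * u ^ n))"
proof (rule summable_comparison_test'[where N = 0])
  show "summable (\<lambda>n. norm u ^ n)" using assms by (simp add: summable_geometric)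
  show "norm (norm ((- 1) ^ n / complex_of_real (q_fact q (f n)) * u ^ n)) \<le> norm u ^ n" for n
    using norm_div_q_fact_le[OF assms(1), of n "u ^ n" "f n"] by (simp add: norm_power)
qed

lemma sums_q_half:
  assumes "q > 0" "norm u < 1"
  shows "(\<lambda>n. (- 1) ^ n / complex_of_real (q_fact q (2 * n)) * u ^ n) sums q_cos_half q u"
    and "(\<lambda>n. (- 1) ^ n / complex_of_real (q_fact q (2 * n + 1)) * u ^ n) sums q_sin_half q u"
  unfolding q_cos_half_def q_sin_half_def
  by (intro summable_sums summable_norm_cancel[OF summable_norm_q_half[OF assms]])+

lemma power_times_2: "(z :: 'a :: monoid_mult) ^ (n * 2) = (z\<^sup>2) ^ n"
  by (metis mult.commute power_mult)

lemma q_cos_eq_half: "q_cos q z = q_cos_half q (z\<^sup>2)"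
  by (simp add: q_cos_def q_cos_half_def power_times_2 mult.commute)

lemma q_sin_eq_half:
  assumes "q > 0" "norm z < 1"
  shows "q_sin q z = z * q_sin_half q (z\<^sup>2)"
proof -
  have "norm (z\<^sup>2) < 1" using assms by (simp add: norm_power power_less_one_iff abs_square_less_1)
  from sums_mult[OF sums_q_half(2)[OF assms(1) this], of z]
  have "(\<lambda>n. (- 1) ^ n * z ^ (2 * n + 1) / complex_of_real (q_fact q (2 * n + 1)))
      sums (z * q_sin_half q (z\<^sup>2))"
    by (simp add: power_times_2 mult_ac)
  then show ?thesis by (simp add: q_sin_def sums_iff)
qed

lemma isCont_q_half:
  assumes "q > 0" "norm u < 1"
  shows "isCont (q_cos_half q) u" "isCont (q_sin_half q) u"
proof -
  obtain r where r: "norm u < r" "r < 1" using assms dense by blast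
  then have K: "norm (complex_of_real r) < 1" "norm u < norm (complex_of_real r)"
    using norm_ge_zero[of u] by (simp_all del: norm_ge_zero)
  note s = sums_summable[OF sums_q_half(1)[OF assms(1) K(1)]]
    sums_summable[OF sums_q_half(2)[OF assms(1) K(1)]]
  show "isCont (q_cos_half q) u" "isCont (q_sin_half q) u"
    unfolding q_cos_half_def[abs_def] q_sin_half_def[abs_def]
    by (rule isCont_powser[OF s(1) K(2)], rule isCont_powser[OF s(2) K(2)])
qed

lemma q_half_0: "q_cos_half q 0 = 1" "q_sin_half q 0 = 1"
  unfolding q_cos_half_def q_sin_half_def by (subst powser_zero, simp add: q_fact_def)+

text \<open>The constant term 1 dominates the rest, which is at most
  \<open>1/4 + 1/16 + ... = 1/3\<close>. The radius \<open>1 / 4\<close> is the bound on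
  \<open>\<xi> * (1 - \<xi>) * z^2\<close> in the unit disc.\<close>

lemma q_cos_half_nonzero:
  assumes "q > 0" "norm u \<le> 1 / 4"
  shows "q_cos_half q u \<noteq> 0"
proof -
  have u: "norm u < 1" using assms by simp
  let ?f = "\<lambda>n. (- 1) ^ n / complex_of_real (q_fact q (2 * n)) * u ^ n"
  have s: "summable ?f" using sums_q_half(1)[OF assms(1) u] by (rule sums_summable)
  have b: "norm (?f (Suc n)) \<le> (1 / 4) * (1 / 4) ^ n" for n
  proof -
    have "norm (?f (Suc n)) \<le> norm u ^ Suc n"
      using norm_div_q_fact_le[OF assms(1), of "Suc n" "u ^ Suc n" "2 * Suc n"]
      by (simp add: norm_power del: power_Suc)
    also have "\<dots> \<le> (1 / 4) ^ Suc n" using assms(2) by (intro power_mono) auto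
    finally show ?thesis by simp
  qed
  have g: "summable (\<lambda>n. (1 / 4) * (1 / 4 :: real) ^ n)" "(\<Sum>n. (1 / 4) * (1 / 4 :: real) ^ n) = 1 / 3"
    using suminf_mult[OF summable_geometric, of "1/4::real" "1/4"] suminf_geometric[of "1/4::real"]
    by (auto intro!: summable_mult summable_geometric)
  have "q_cos_half q u = 1 + (\<Sum>n. ?f (Suc n))"
    using suminf_split_head[OF s] by (simp add: q_cos_half_def q_fact_def)
  moreover have "norm (\<Sum>n. ?f (Suc n)) \<le> 1 / 3"
    using norm_suminf_le[OF b g(1)] g(2) by simp
  moreover have "norm (- 1 :: complex) = 1" by simp
  ultimately show ?thesis by (auto simp: add_eq_0_iff)
qed

text \<open>The closed form after cancelling \<open>sqrt (\<xi> * (1 - \<xi>)) * z\<close>. It makes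
  sense at \<open>z = 0\<close> and at \<open>\<xi> = 0\<close> and \<open>\<xi> = 1\<close>, and so
  supplies the values that the formula takes there by continuity.\<close>

definition persistence_value :: "real \<Rightarrow> real \<Rightarrow> complex \<Rightarrow> complex" where
  "persistence_value q \<xi> z =
     (let u = complex_of_real (\<xi> * (1 - \<xi>)) * z\<^sup>2 in
        q_sin_half q u / (q_cos_half q u - complex_of_real (1 - \<xi>) * z * q_sin_half q u) - 1)"

lemma variance_bound:
  fixes \<xi> :: real
  assumes "0 \<le> \<xi>" "\<xi> \<le> 1"
  shows "0 \<le> \<xi> * (1 - \<xi>)" "\<xi> * (1 - \<xi>) \<le> 1 / 4"
proof -
  have "0 \<le> (\<xi> - 1 / 2)\<^sup>2" by simp
  then show "\<xi> * (1 - \<xi>) \<le> 1 / 4" by (simp add: power2_eq_square algebra_simps)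
qed (use assms in simp)

lemma norm_argument_bound:
  assumes "0 \<le> \<xi>" "\<xi> \<le> 1" "norm (z :: complex) < 1"
  shows "norm (complex_of_real (\<xi> * (1 - \<xi>)) * z\<^sup>2) \<le> 1 / 4"
proof -
  have "(norm z)\<^sup>2 \<le> 1" using assms(3) by (simp add: power_le_one)
  then have "\<xi> * (1 - \<xi>) * (norm z)\<^sup>2 \<le> 1 / 4 * 1"
    using variance_bound[OF assms(1,2)] by (intro mult_mono) auto
  then show ?thesis using variance_bound[OF assms(1,2)]
    unfolding norm_mult norm_of_real norm_power by simp
qed

text \<open>With \<open>a = sqrt (\<xi> * (1 - \<xi>))\<close>, the q-sine at \<open>a * z\<close>
  has the factor \<open>a * z\<close>, and
  \<open>sqrt ((1 - \<xi>) / \<xi>) * a = 1 - \<xi>\<close>; all roots cancel.\<close>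

lemma persistence_gf_formula_eq:
  assumes "\<theta> < 0" "0 < \<xi>" "\<xi> < 1" "norm z < 1" "z \<noteq> 0"
  shows "persistence_gf_formula \<theta> \<xi> z = persistence_value (- \<theta>) \<xi> z"
proof -
  define a where "a = sqrt (\<xi> * (1 - \<xi>))"
  have a: "a > 0" "a\<^sup>2 = \<xi> * (1 - \<xi>)" using assms by (simp_all add: a_def)
  have ba: "sqrt ((1 - \<xi>) / \<xi>) * a = 1 - \<xi>"
    using assms by (simp add: a_def real_sqrt_mult real_sqrt_divide)
  have "a\<^sup>2 \<le> 1\<^sup>2" using variance_bound[of \<xi>] assms a by simp
  then have "a \<le> 1" by (rule power2_le_imp_le) simp
  then have "a * norm z \<le> norm z" using a(1) by (intro mult_left_le_one_le) auto
  also have "\<dots> < 1" by fact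
  finally have az: "norm (complex_of_real a * z) < 1" using a(1) by (simp add: norm_mult)
  have sq: "(complex_of_real a * z)\<^sup>2 = complex_of_real (\<xi> * (1 - \<xi>)) * z\<^sup>2"
    unfolding power_mult_distrib of_real_power[symmetric] a(2) ..
  define S where "S = q_sin_half (- \<theta>) (complex_of_real (\<xi> * (1 - \<xi>)) * z\<^sup>2)"
  have S: "q_sin (- \<theta>) (complex_of_real a * z) = complex_of_real a * z * S"
    unfolding S_def sq[symmetric] by (rule q_sin_eq_half) (use assms az in auto)
  have bS: "complex_of_real (sqrt ((1 - \<xi>) / \<xi>)) * (complex_of_real a * z * S) = complex_of_real (1 - \<xi>) * z * S"
    using arg_cong[OF ba, of complex_of_real] by (simp only: of_real_mult mult.assoc[symmetric])
  \<comment> \<open>Division by zero gives zero, so this covers \<open>d = 0\<close> too and zeros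
    of the denominator cause no exception.\<close>
  have quot: "1 / (z * complex_of_real a) * (complex_of_real a * z * S / d) = S / d" for d
    using assms a(1) by simp
  show ?thesis
    unfolding persistence_gf_formula_def persistence_value_def Let_def a_def[symmetric] S bS
      S_def[symmetric] q_cos_eq_half sq quot ..
qed

lemma persistence_value_0: "persistence_value q \<xi> 0 = 0"
  by (simp add: persistence_value_def q_half_0)

text \<open>At \<open>z = 0\<close> the limit follows from agreement on the punctured unit disc and
  continuity of the two half series at 0.\<close>

lemma has_value_cont0_persistence_gf_formula:
  assumes "\<theta> < 0" "0 < \<xi>" "\<xi> < 1" "norm z < 1"
  shows "has_value_cont0 (persistence_gf_formula \<theta> \<xi>) z (persistence_value (- \<theta>) \<xi> z)"
proof (cases "z = 0")
  case True
  have u: "((\<lambda>z :: complex. complex_of_real (\<xi> * (1 - \<xi>)) * z\<^sup>2) \<longlongrightarrow> 0) (at 0)"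
    by (auto intro!: tendsto_eq_intros)
  have c: "isCont (q_cos_half (- \<theta>)) 0" "isCont (q_sin_half (- \<theta>)) 0"
    using assms by (auto intro!: isCont_q_half)
  have "(persistence_value (- \<theta>) \<xi> \<longlongrightarrow> 1 / (1 - complex_of_real (1 - \<xi>) * 0 * 1) - 1) (at 0)"
    unfolding persistence_value_def[abs_def] Let_def
    using isCont_tendsto_compose[OF c(1) u] isCont_tendsto_compose[OF c(2) u]
    by (intro tendsto_intros) (auto simp: q_half_0)
  moreover have "\<forall>\<^sub>F z in at 0. persistence_gf_formula \<theta> \<xi> z = persistence_value (- \<theta>) \<xi> z"
    unfolding eventually_at using assms
    by (intro exI[of _ 1]) (auto simp: persistence_gf_formula_eq)
  ultimately show ?thesis
    using True by (simp add: has_value_cont0_def persistence_value_0 tendsto_cong)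
next
  case False
  then show ?thesis using assms by (simp add: has_value_cont0_def persistence_gf_formula_eq)
qed

text \<open>At both end points the argument of the half series vanishes, and the denominator tends
  to \<open>1 - z\<close> or to 1, nonzero in the unit disc.\<close>

lemma isCont_persistence_value:
  assumes "q > 0" "s = 0 \<or> s = 1" "norm z < 1"
  shows "isCont (\<lambda>\<xi>. persistence_value q \<xi> z) s"
proof -
  have u: "((\<lambda>\<xi>. complex_of_real (\<xi> * (1 - \<xi>)) * z\<^sup>2) \<longlongrightarrow> 0) (at s)"
    using assms(2) by (auto intro!: tendsto_eq_intros)
  have c: "isCont (q_cos_half q) 0" "isCont (q_sin_half q) 0"
    using assms by (auto intro!: isCont_q_half)
  have "z \<noteq> 1" using assms(3) by auto
  then have "((\<lambda>\<xi>. persistence_value q \<xi> z) \<longlongrightarrow> 1 / (1 - complex_of_real (1 - s) * z * 1) - 1) (at s)"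
    unfolding persistence_value_def[abs_def] Let_def
    using isCont_tendsto_compose[OF c(1) u] isCont_tendsto_compose[OF c(2) u] assms(2)
    by (intro tendsto_intros) (auto simp: q_half_0)
  moreover have "persistence_value q s z = 1 / (1 - complex_of_real (1 - s) * z * 1) - 1"
    using assms(2) by (auto simp: persistence_value_def q_half_0)
  ultimately show ?thesis by (simp add: isCont_def)
qed

section \<open>From the convolution identity to the closed form\<close>

lemma sums_even_odd:
  fixes f :: "nat \<Rightarrow> 'b :: real_normed_vector"
  assumes "(\<lambda>n. f (2 * n)) sums s" "(\<lambda>n. f (2 * n + 1)) sums t"
  shows "f sums (s + t)"
proof -
  have e: "(\<lambda>n. if even n then f n else 0) sums s"
  proof (subst sums_mono_reindex[of "\<lambda>n. 2 * n", symmetric])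
    show "strict_mono (\<lambda>n :: nat. 2 * n)" by (simp add: strict_mono_def)
  qed (use assms(1) in \<open>auto elim!: evenE\<close>)
  have "(\<lambda>n. if odd n then f n else 0) sums t"
  proof (subst sums_mono_reindex[of "\<lambda>n. 2 * n + 1", symmetric])
    show "strict_mono (\<lambda>n :: nat. 2 * n + 1)" by (simp add: strict_mono_def)
  qed (use assms(2) in \<open>auto elim!: oddE\<close>)
  from sums_add[OF e this] show ?thesis
    by (rule sums_cong[THEN iffD1, rotated]) auto
qed

lemma sums_even:
  fixes f :: "nat \<Rightarrow> 'b :: real_normed_vector"
  assumes "(\<lambda>n. f (2 * n)) sums s" "\<And>n. odd n \<Longrightarrow> f n = 0"
  shows "f sums s"
  using sums_even_odd[OF assms(1), of 0] assms(2) by simp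

text \<open>The convolution is a Cauchy product: the series of \<open>denom_coeff\<close> times that
  of \<open>p\<close> is \<open>q_sin_half q u\<close>.\<close>

lemma persistence_series_eq:
  fixes p :: "nat \<Rightarrow> real"
  assumes q: "q > 0" and \<xi>: "0 \<le> \<xi>" "\<xi> \<le> 1" and p: "\<And>n. \<bar>p n\<bar> \<le> 1" and z: "norm z < 1"
    and conv: "\<And>n. (\<Sum>k\<le>n. denom_coeff q \<xi> k * p (n - k)) =
      (if even n then (- (\<xi> * (1 - \<xi>))) ^ (n div 2) / q_fact q (Suc n) else 0)"
  shows "(\<Sum>n. complex_of_real (p (Suc n)) * z ^ Suc n) = persistence_value q \<xi> z"
proof -
  define m where "m = \<xi> * (1 - \<xi>)"
  define u where "u = complex_of_real m * z\<^sup>2"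
  have u: "norm u \<le> 1 / 4" unfolding u_def m_def by (rule norm_argument_bound[OF \<xi> z])
  have u1: "norm u < 1" using u by simp
  have m: "0 \<le> m" "m \<le> 1" using variance_bound[OF \<xi>] by (auto simp: m_def)
  have summable_bounded: "summable (\<lambda>n. norm (complex_of_real (f n) * z ^ n))"
    if f: "\<And>n. \<bar>f n\<bar> \<le> 1" for f :: "nat \<Rightarrow> real"
  proof (rule summable_comparison_test'[where N = 0])
    show "summable (\<lambda>n. norm z ^ n)" using z by (simp add: summable_geometric)
    show "norm (norm (complex_of_real (f n) * z ^ n)) \<le> norm z ^ n" for n
      using f[of n] by (simp add: norm_mult norm_power mult_left_le_one_le)
  qed
  \<comment> \<open>With coefficients bounded by 1, as the \<open>p n\<close> are, both series
    converge absolutely in the unit disc and may be multiplied.\<close>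
  have "\<bar>denom_coeff q \<xi> n\<bar> \<le> 1" for n
  proof -
    have "m ^ (n div 2) \<le> 1" using m by (intro power_le_one)
    moreover have "\<bar>if even n then 1 else - (1 - \<xi>)\<bar> \<le> 1" using \<xi> by auto
    ultimately have "\<bar>if even n then 1 else - (1 - \<xi>)\<bar> * m ^ (n div 2) \<le> 1"
      using m by (intro mult_le_one) auto
    moreover have "q_fact q n \<ge> 1" by (rule q_fact_ge_1[OF q])
    ultimately show ?thesis
      unfolding denom_coeff_def m_def[symmetric] using m
      by (simp add: abs_mult power_abs divide_le_eq)
  qed
  note sd = summable_bounded[of "denom_coeff q \<xi>", OF this] and sp = summable_bounded[of p, OF p]
  have "(\<lambda>n. complex_of_real (denom_coeff q \<xi> n) * z ^ n) sums
      (q_cos_half q u + (- complex_of_real (1 - \<xi>) * z) * q_sin_half q u)"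
  proof (rule sums_even_odd)
    show "(\<lambda>n. complex_of_real (denom_coeff q \<xi> (2 * n)) * z ^ (2 * n)) sums q_cos_half q u"
      using sums_q_half(1)[OF q u1]
      by (simp add: denom_coeff_def u_def power_times_2 power_mult_distrib power_minus[of "complex_of_real m"]
          mult_ac flip: m_def)
    show "(\<lambda>n. complex_of_real (denom_coeff q \<xi> (2 * n + 1)) * z ^ (2 * n + 1)) sums
        ((- complex_of_real (1 - \<xi>) * z) * q_sin_half q u)"
      using sums_mult[OF sums_q_half(2)[OF q u1], of "- complex_of_real (1 - \<xi>) * z"]
      by (simp add: denom_coeff_def u_def power_times_2 power_mult_distrib power_minus[of "complex_of_real m"]
          mult_ac flip: m_def)
  qed
  then have D: "(\<Sum>n. complex_of_real (denom_coeff q \<xi> n) * z ^ n) =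
      q_cos_half q u - complex_of_real (1 - \<xi>) * z * q_sin_half q u"
    by (simp only: sums_iff mult_minus_left add_uminus_conv_diff)
  have conv': "(\<Sum>i\<le>n. complex_of_real (denom_coeff q \<xi> i) * z ^ i * (complex_of_real (p (n - i)) * z ^ (n - i)))
      = complex_of_real (if even n then (- m) ^ (n div 2) / q_fact q (Suc n) else 0) * z ^ n" for n
  proof -
    have "(\<Sum>i\<le>n. complex_of_real (denom_coeff q \<xi> i) * z ^ i * (complex_of_real (p (n - i)) * z ^ (n - i)))
        = (\<Sum>i\<le>n. complex_of_real (denom_coeff q \<xi> i * p (n - i)) * z ^ n)"
      by (intro sum.cong refl) (simp add: mult_ac flip: power_add)
    also have "\<dots> = complex_of_real (\<Sum>i\<le>n. denom_coeff q \<xi> i * p (n - i)) * z ^ n"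
      by (simp add: sum_distrib_right)
    finally show ?thesis unfolding conv m_def .
  qed
  have "(\<lambda>n. complex_of_real (if even n then (- m) ^ (n div 2) / q_fact q (Suc n) else 0) * z ^ n)
      sums q_sin_half q u"
    by (rule sums_even)
       (use sums_q_half(2)[OF q u1] in
        \<open>simp_all add: u_def power_times_2 power_mult_distrib power_minus[of "complex_of_real m"] mult_ac\<close>)
  then have prod: "(q_cos_half q u - complex_of_real (1 - \<xi>) * z * q_sin_half q u) *
      (\<Sum>n. complex_of_real (p n) * z ^ n) = q_sin_half q u"
    by (rule sums_unique2[OF Cauchy_product_sums[OF sd sp, unfolded conv' D]])
  \<comment> \<open>If the denominator vanished, \<open>prod\<close> would give
    \<open>q_sin_half q u = 0\<close>; the denominator would then equal
    \<open>q_cos_half q u\<close>, which is nonzero.\<close>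
  have "q_cos_half q u - complex_of_real (1 - \<xi>) * z * q_sin_half q u \<noteq> 0"
    using prod q_cos_half_nonzero[OF q u] by auto
  then have "(\<Sum>n. complex_of_real (p n) * z ^ n) =
      q_sin_half q u / (q_cos_half q u - complex_of_real (1 - \<xi>) * z * q_sin_half q u)"
    using prod by (simp add: field_simps)
  \<comment> \<open>The generating function starts at index 1; removing \<open>p 0 = 1\<close>
    produces the final \<open>- 1\<close>.\<close>
  moreover have "p 0 = 1" using conv[of 0] by (simp add: denom_coeff_def q_fact_def)
  ultimately show ?thesis
    using suminf_split_head[OF summable_norm_cancel[OF sp]]
    by (simp add: persistence_value_def Let_def flip: m_def u_def)
qed

lemma q_cos_1: "q_cos 1 z = cos z"
proof -
  have "(\<lambda>n. cos_coeff (2 * n) *\<^sub>R z ^ (2 * n)) sums cos z"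
    using cos_converges[of z]
    by (subst sums_mono_reindex[of "\<lambda>n. 2 * n" "\<lambda>n. cos_coeff n *\<^sub>R z ^ n"])
       (auto simp: strict_mono_def cos_coeff_def elim!: evenE)
  then show ?thesis
    by (simp add: q_cos_def cos_coeff_def q_fact_1 scaleR_conv_of_real sums_iff)
qed

lemma q_sin_1: "q_sin 1 z = sin z"
proof -
  have "(\<lambda>n. sin_coeff (2 * n + 1) *\<^sub>R z ^ (2 * n + 1)) sums sin z"
    using sin_converges[of z]
    by (subst sums_mono_reindex[of "\<lambda>n. 2 * n + 1" "\<lambda>n. sin_coeff n *\<^sub>R z ^ n"])
       (auto simp: strict_mono_def sin_coeff_def elim!: oddE)
  then show ?thesis
    by (simp add: q_sin_def sin_coeff_def q_fact_1 scaleR_conv_of_real sums_iff)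
qed

text \<open>Both roots are explicit here: \<open>1 / 2\<close> and 1. Equality for every
  \<open>w\<close>, including \<open>w = 0\<close>, allows rewriting under
  \<open>has_value_cont0\<close>.\<close>

lemma persistence_gf_formula_half:
  "persistence_gf_formula (- 1) (1 / 2) w = 2 / w * sin (w / 2) / (cos (w / 2) - sin (w / 2)) - 1"
proof -
  have h: "sqrt (1 / 2 * (1 - 1 / 2)) = 1 / 2" by (rule real_sqrt_unique) (simp_all add: power2_eq_square)
  show ?thesis
    unfolding persistence_gf_formula_def Let_def h by (simp add: q_cos_1 q_sin_1 mult.commute)
qed

subsection \<open>Coefficients\<close>

text \<open>A tuple \<open>j\<close> corresponds to the multiset in which \<open>k\<close> occurs
  \<open>j k\<close> times; this converts the multiset-indexed product formula into a sum over
  tuples.\<close>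

lemma fps_nth_power_PiE:
  fixes T :: "'b :: comm_semiring_1 fps"
  shows "fps_nth (T ^ r) n =
    (\<Sum>j\<in>{j \<in> {1..r} \<rightarrow>\<^sub>E UNIV. (\<Sum>k=1..r. j k) = n}. \<Prod>k=1..r. fps_nth T (j k))"
proof -
  have "fps_nth (T ^ r) n = fps_nth (\<Prod>k\<in>{1..r}. T) n" by simp
  also have "\<dots> = (\<Sum>Y\<in>multisets_of_size {1..r} n. \<Prod>k\<in>{1..r}. fps_nth T (count Y k))"
    by (rule fps_prod_nth') simp
  also have "\<dots> = (\<Sum>j\<in>{j \<in> {1..r} \<rightarrow>\<^sub>E UNIV. (\<Sum>k=1..r. j k) = n}. \<Prod>k=1..r. fps_nth T (j k))"
  proof (rule sum.reindex_bij_witness[where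
        i = "\<lambda>j. Abs_multiset (\<lambda>k. if k \<in> {1..r} then j k else 0)" and
        j = "\<lambda>Y. restrict (count Y) {1..r}"])
    fix Y assume "Y \<in> multisets_of_size {1..r} n"
    then have Y: "set_mset Y \<subseteq> {1..r}" "size Y = n" by (auto simp: multisets_of_size_def)
    have "(\<lambda>k. if k \<in> {1..r} then restrict (count Y) {1..r} k else 0) = count Y"
      using Y(1) by (auto simp: fun_eq_iff restrict_def count_eq_zero_iff)
    then show "Abs_multiset (\<lambda>k. if k \<in> {1..r} then restrict (count Y) {1..r} k else 0) = Y"
      by (simp add: count_inverse)
    have "(\<Sum>k=1..r. count Y k) = size Y"
      unfolding size_multiset_overloaded_eq
      using Y(1) by (intro sum.mono_neutral_right) (auto simp: count_eq_zero_iff)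
    then show "restrict (count Y) {1..r} \<in> {j \<in> {1..r} \<rightarrow>\<^sub>E UNIV. (\<Sum>k=1..r. j k) = n}"
      using Y(2) by simp
  next
    fix j assume j: "j \<in> {j \<in> {1..r} \<rightarrow>\<^sub>E UNIV. (\<Sum>k=1..r. j k) = n}"
    let ?Y = "Abs_multiset (\<lambda>k. if k \<in> {1..r} then j k else 0)"
    have c: "count ?Y = (\<lambda>k. if k \<in> {1..r} then j k else 0)"
    proof (rule count_Abs_multiset)
      show "finite {k. 0 < (if k \<in> {1..r} then j k else 0)}"
        by (rule finite_subset[of _ "{1..r}"]) auto
    qed
    have s: "set_mset ?Y \<subseteq> {1..r}" by (auto simp: set_mset_def c split: if_splits)
    have "size ?Y = (\<Sum>k=1..r. count ?Y k)"
      unfolding size_multiset_overloaded_eq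
      using s by (intro sum.mono_neutral_left) (auto simp: count_eq_zero_iff simp del: count_Abs_multiset)
    then show "?Y \<in> multisets_of_size {1..r} n"
      using s j by (simp add: multisets_of_size_def c)
    show "restrict (count ?Y) {1..r} = j"
      using j by (auto simp: c fun_eq_iff restrict_def PiE_def extensional_def)
  qed simp
  finally show ?thesis .
qed

lemma fps_nth_power_odd_compositions:
  fixes T :: "real fps"
  assumes "\<And>n. even n \<Longrightarrow> fps_nth T n = 0"
  shows "fps_nth (T ^ r) n = (\<Sum>j\<in>odd_compositions r n. \<Prod>k=1..r. fps_nth T (j k))"
  unfolding fps_nth_power_PiE
proof (rule sum.mono_neutral_right)
  show "finite {j \<in> {1..r} \<rightarrow>\<^sub>E (UNIV :: nat set). (\<Sum>k=1..r. j k) = n}"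
  proof (rule finite_subset)
    show "{j \<in> {1..r} \<rightarrow>\<^sub>E UNIV. (\<Sum>k=1..r. j k) = n} \<subseteq> {1..r} \<rightarrow>\<^sub>E {..n}"
    proof
      fix j assume j: "j \<in> {j \<in> {1..r} \<rightarrow>\<^sub>E UNIV. (\<Sum>k=1..r. j k) = n}"
      have "j k \<le> n" if "k \<in> {1..r}" for k
        using j member_le_sum[OF that, of j] by simp
      with j show "j \<in> {1..r} \<rightarrow>\<^sub>E {..n}" by (auto simp: PiE_def)
    qed
  qed (intro finite_PiE, auto)
  show "odd_compositions r n \<subseteq> {j \<in> {1..r} \<rightarrow>\<^sub>E UNIV. (\<Sum>k=1..r. j k) = n}"
    by (auto simp: odd_compositions_def PiE_def)
  show "\<forall>j\<in>{j \<in> {1..r} \<rightarrow>\<^sub>E UNIV. (\<Sum>k=1..r. j k) = n} - odd_compositions r n.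
      (\<Prod>k=1..r. fps_nth T (j k)) = 0"
  proof
    fix j assume j: "j \<in> {j \<in> {1..r} \<rightarrow>\<^sub>E UNIV. (\<Sum>k=1..r. j k) = n} - odd_compositions r n"
    then obtain k where "k \<in> {1..r}" "j k \<notin> {i. 1 \<le> i \<and> odd i}"
      by (auto simp: odd_compositions_def PiE_def Pi_def)
    then have "k \<in> {1..r}" "even (j k)" by (auto simp: not_le)
    then show "(\<Prod>k=1..r. fps_nth T (j k)) = 0"
      using assms by (intro prod_zero bexI[of _ k]) auto
  qed
qed

section \<open>The q-tangent series and the coefficient formula\<close>

lemma fps_nth_q_cos_fps_0: "fps_nth (q_cos_fps q) 0 = 1"
  by (simp add: q_cos_fps_def q_fact_def)

lemma fps_nth_q_sin_fps_0: "fps_nth (q_sin_fps q) 0 = 0"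
  by (simp add: q_sin_fps_def)

text \<open>Replacing the variable by its negative fixes the even series \<open>C\<close>, so it
  sends \<open>inverse C\<close> to an inverse of \<open>C\<close> again (\<open>I\<close> below).
  Inverses are unique, hence \<open>inverse C\<close> is even.\<close>

lemma fps_nth_odd_inverse:
  fixes C :: "real fps"
  assumes "fps_nth C 0 = 1" "\<And>n. odd n \<Longrightarrow> fps_nth C n = 0" "odd n"
  shows "fps_nth (inverse C) n = 0"
proof -
  define I where "I = Abs_fps (\<lambda>n. (- 1) ^ n * fps_nth (inverse C) n)"
  have inv: "inverse C * C = 1" using assms(1) by (intro inverse_mult_eq_1) simp
  have "I * C = 1"
  proof (rule fps_ext)
    fix n
    have "fps_nth (I * C) n = (\<Sum>i=0..n. (- 1) ^ n * (fps_nth (inverse C) i * fps_nth C (n - i)))"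
      unfolding fps_mult_nth
    proof (intro sum.cong refl)
      fix i assume "i \<in> {0..n}"
      show "fps_nth I i * fps_nth C (n - i) = (- 1) ^ n * (fps_nth (inverse C) i * fps_nth C (n - i))"
      proof (cases "even (n - i)")
        case True
        have "(- 1 :: real) ^ n = (- 1) ^ i * (- 1) ^ (n - i)"
          using \<open>i \<in> {0..n}\<close> by (simp flip: power_add)
        also have "\<dots> = (- 1) ^ i" using True by simp
        finally show ?thesis by (simp add: I_def)
      qed (simp add: assms(2))
    qed
    also have "\<dots> = (- 1) ^ n * fps_nth (inverse C * C) n"
      by (simp add: fps_mult_nth sum_distrib_left)
    finally show "fps_nth (I * C) n = fps_nth 1 n" by (simp add: inv)
  qed
  then have "I * C * inverse C = inverse C" by simp
  then have "I = inverse C"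
    using inv by (simp add: mult.assoc mult.commute[of C])
  then have "fps_nth I n = fps_nth (inverse C) n" by simp
  then show ?thesis using \<open>odd n\<close> by (simp add: I_def)
qed

text \<open>The q-secant is even and the q-tangent odd, so at odd indices the zigzag series has
  exactly the coefficients of the q-tangent.\<close>

lemma fps_nth_q_tan:
  shows "even n \<Longrightarrow> fps_nth (q_sin_fps q / q_cos_fps q) n = 0"
    and "q > 0 \<Longrightarrow> odd n \<Longrightarrow> fps_nth (q_sin_fps q / q_cos_fps q) n = q_zigzag q n / q_fact q n"
proof -
  have odd_inv: "odd n \<Longrightarrow> fps_nth (inverse (q_cos_fps q)) n = 0" for n
    by (rule fps_nth_odd_inverse) (auto simp: q_cos_fps_def q_fact_def)
  have d: "f / q_cos_fps q = f * inverse (q_cos_fps q)" for f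
    by (rule fps_divide_unit) (simp add: fps_nth_q_cos_fps_0)
  show "fps_nth (q_sin_fps q / q_cos_fps q) n = 0" if "even n"
    unfolding d fps_mult_nth
  proof (rule sum.neutral, rule ballI)
    fix i assume "i \<in> {0..n}"
    show "fps_nth (q_sin_fps q) i * fps_nth (inverse (q_cos_fps q)) (n - i) = 0"
      using \<open>i \<in> {0..n}\<close> \<open>even n\<close> by (cases "even i") (simp_all add: q_sin_fps_def odd_inv)
  qed
  show "fps_nth (q_sin_fps q / q_cos_fps q) n = q_zigzag q n / q_fact q n" if "q > 0" "odd n"
  proof -
    have "q_fact q n \<noteq> 0" "n \<noteq> 0" using q_fact_ge_1[OF \<open>q > 0\<close>, of n] \<open>odd n\<close> by (auto elim: oddE)
    then show ?thesis using odd_inv[OF \<open>odd n\<close>] by (simp add: q_zigzag_def d)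
  qed
qed

text \<open>Iterating the equation \<open>N\<close> times yields a partial geometric sum and the
  remainder \<open>b ^ N * T ^ N * W\<close>. As \<open>T\<close> and \<open>W\<close> have no
  constant term, the remainder starts at degree \<open>N + 1\<close> and is invisible at
  \<open>n \<le> N\<close>.\<close>

lemma fps_nth_geometric:
  fixes T W :: "'b :: comm_ring_1 fps"
  assumes W: "W = T + fps_const b * T * W" and "fps_nth T 0 = 0" and "n \<le> N"
  shows "fps_nth W n = (\<Sum>r=1..N. b ^ (r - 1) * fps_nth (T ^ r) n)"
proof -
  have "W = (\<Sum>r=1..N. fps_const (b ^ (r - 1)) * T ^ r) + fps_const (b ^ N) * T ^ N * W" for N
  proof (induction N)
    case (Suc N)
    have "fps_const (b ^ N) * T ^ N * W = fps_const (b ^ N) * T ^ N * (T + fps_const b * T * W)"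
      using W by simp
    also have "\<dots> = fps_const (b ^ N) * T ^ Suc N + fps_const (b ^ Suc N) * T ^ Suc N * W"
      by (simp add: algebra_simps flip: fps_const_mult)
    finally show ?case using Suc by (simp add: add.assoc)
  qed simp
  then have "fps_nth W n = (\<Sum>r=1..N. b ^ (r - 1) * fps_nth (T ^ r) n) + b ^ N * fps_nth (T ^ N * W) n"
    by (metis (no_types, lifting) fps_add_nth fps_mult_left_const_nth fps_sum_nth mult.assoc sum.cong)
  moreover have "fps_nth (T ^ N * W) n = 0"
  proof -
    have T: "T = fps_X * fps_shift 1 T"
      using assms(2) by (simp add: fps_eq_iff)
    have "fps_nth W 0 = 0"
      by (subst W) (simp add: assms(2))
    then have W': "W = fps_X * fps_shift 1 W"
      by (simp add: fps_eq_iff)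
    have "(fps_X * T') ^ N * (fps_X * W') = fps_X ^ Suc N * (T' ^ N * W')" for T' W' :: "'b fps"
      by (simp add: power_mult_distrib mult_ac)
    from this[of "fps_shift 1 T" "fps_shift 1 W", folded T W']
    show ?thesis using \<open>n \<le> N\<close> by (simp add: fps_X_power_mult_nth del: power_Suc)
  qed
  ultimately show ?thesis by simp
qed

text \<open>After rescaling, the convolution reads \<open>fps_X * P * (C - b S) = S\<close>.
  Dividing by \<open>C\<close> gives \<open>W = T + b T W\<close> for \<open>W = fps_X * P\<close>
  and the q-tangent \<open>T\<close>, whose solution is a geometric series in
  \<open>T\<close>.\<close>

lemma persistence_coefficients:
  fixes p :: "nat \<Rightarrow> real"
  assumes q: "q > 0" and \<xi>: "0 < \<xi>" "\<xi> < 1"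
    and conv: "\<And>n. (\<Sum>k\<le>n. denom_coeff q \<xi> k * p (n - k)) =
      (if even n then (- (\<xi> * (1 - \<xi>))) ^ (n div 2) / q_fact q (Suc n) else 0)"
  shows "p n = (\<xi> * (1 - \<xi>)) powr (real n / 2) *
     (\<Sum>r=1..n+1. sqrt ((1 - \<xi>) / \<xi>) ^ (r - 1) *
        (\<Sum>j\<in>odd_compositions r (n + 1). \<Prod>k=1..r. q_zigzag q (j k) / q_fact q (j k)))"
proof -
  define a where "a = sqrt (\<xi> * (1 - \<xi>))"
  define b where "b = sqrt ((1 - \<xi>) / \<xi>)"
  define C S where "C = q_cos_fps q" and "S = q_sin_fps q"
  define D where "D = C - fps_const b * S"
  define T where "T = S / C"
  \<comment> \<open>Dividing by \<open>a ^ n\<close> replaces the variable \<open>z\<close> by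
    \<open>z / a\<close>, so that \<open>C\<close> and \<open>S\<close> appear unscaled.\<close>
  define P where "P = Abs_fps (\<lambda>n. p n / a ^ n)"
  have a: "a > 0" "a\<^sup>2 = \<xi> * (1 - \<xi>)" using \<xi> by (simp_all add: a_def)
  have ba: "b * a = 1 - \<xi>" using \<xi> by (simp add: a_def b_def real_sqrt_mult real_sqrt_divide)
  have C0: "fps_nth C 0 = 1" and S0: "fps_nth S 0 = 0"
    by (simp_all add: C_def S_def fps_nth_q_cos_fps_0 fps_nth_q_sin_fps_0)
  have pw: "(- (\<xi> * (1 - \<xi>))) ^ k = (- 1) ^ k * a ^ (2 * k)" for k
    unfolding a(2)[symmetric] power_minus[of "a\<^sup>2"] power_mult ..
  \<comment> \<open>For odd \<open>k\<close> one spare factor \<open>a\<close> turns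
    \<open>b\<close> into \<open>1 - \<xi>\<close>; the remaining even power of \<open>a\<close> is
    a power of \<open>\<xi> * (1 - \<xi>)\<close>.\<close>
  have D: "fps_nth D k * a ^ k = denom_coeff q \<xi> k" for k
  proof (cases "even k")
    case True
    then show ?thesis
      unfolding denom_coeff_def pw by (simp add: D_def C_def S_def q_cos_fps_def q_sin_fps_def)
  next
    case False
    then obtain i where "k = 2 * i + 1" by (elim oddE)
    then show ?thesis
      unfolding denom_coeff_def pw unfolding ba[symmetric] by (simp add: D_def C_def S_def q_cos_fps_def q_sin_fps_def)
  qed
  have "fps_X * P * D = S"
  proof (rule fps_ext)
    fix n
    show "fps_nth (fps_X * P * D) n = fps_nth S n"
    proof (cases n)
      case (Suc k)
      have "fps_nth (fps_X * P * D) n = fps_nth (D * P) k"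
        by (simp add: Suc mult.assoc mult.commute[of P])
      also have "\<dots> = (\<Sum>i\<le>k. denom_coeff q \<xi> i * p (k - i) / a ^ k)"
        unfolding fps_mult_nth atLeast0AtMost
      proof (intro sum.cong refl)
        fix i assume "i \<in> {..k}"
        then have "a ^ k = a ^ i * a ^ (k - i)" by (simp flip: power_add)
        then show "fps_nth D i * fps_nth P (k - i) = denom_coeff q \<xi> i * p (k - i) / a ^ k"
          using a(1) by (simp add: P_def field_simps flip: D)
      qed
      also have "\<dots> = (if even k then (- (\<xi> * (1 - \<xi>))) ^ (k div 2) / q_fact q (Suc k) else 0) / a ^ k"
        unfolding sum_divide_distrib[symmetric] conv ..
      also have "\<dots> = fps_nth S n"
        unfolding pw using a(1) by (simp add: S_def q_sin_fps_def Suc)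
      finally show ?thesis .
    qed (simp add: S0)
  qed
  moreover have "S = T * C"
    unfolding T_def using C0 by (simp add: fps_divide_unit mult.assoc inverse_mult_eq_1)
  ultimately have "(fps_X * P) * C = (T + fps_const b * T * (fps_X * P)) * C"
    by (simp add: D_def algebra_simps)
  moreover have "C \<noteq> 0" using C0 by auto
  ultimately have geo: "fps_X * P = T + fps_const b * T * (fps_X * P)"
    by (metis mult_right_cancel)
  have T0: "fps_nth T 0 = 0" using C0 S0 by (simp add: T_def fps_divide_unit)
  \<comment> \<open>The factor \<open>fps_X\<close> is why the compositions are of
    \<open>n + 1\<close>.\<close>
  have "p n / a ^ n = fps_nth (fps_X * P) (n + 1)" by (simp add: P_def)
  also have "\<dots> = (\<Sum>r=1..n+1. b ^ (r - 1) * fps_nth (T ^ r) (n + 1))"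
    by (rule fps_nth_geometric[OF geo T0]) simp
  also have "\<dots> = (\<Sum>r=1..n+1. b ^ (r - 1) *
      (\<Sum>j\<in>odd_compositions r (n + 1). \<Prod>k=1..r. q_zigzag q (j k) / q_fact q (j k)))"
  proof (intro sum.cong arg_cong2[where f = times] refl)
    fix r
    have "fps_nth (T ^ r) (n + 1) = (\<Sum>j\<in>odd_compositions r (n + 1). \<Prod>k=1..r. fps_nth T (j k))"
      by (rule fps_nth_power_odd_compositions) (simp add: T_def S_def C_def fps_nth_q_tan(1))
    also have "\<dots> = (\<Sum>j\<in>odd_compositions r (n + 1). \<Prod>k=1..r. q_zigzag q (j k) / q_fact q (j k))"
    proof (intro sum.cong prod.cong refl)
      fix j k assume "j \<in> odd_compositions r (n + 1)" "k \<in> {1..r}"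
      then have "odd (j k)" by (auto simp: odd_compositions_def PiE_def Pi_def)
      then show "fps_nth T (j k) = q_zigzag q (j k) / q_fact q (j k)"
        by (simp add: T_def S_def C_def fps_nth_q_tan(2)[OF q])
    qed
    finally show "fps_nth (T ^ r) (n + 1) =
        (\<Sum>j\<in>odd_compositions r (n + 1). \<Prod>k=1..r. q_zigzag q (j k) / q_fact q (j k))" .
  qed
  finally have "p n = a ^ n * (\<Sum>r=1..n+1. b ^ (r - 1) *
      (\<Sum>j\<in>odd_compositions r (n + 1). \<Prod>k=1..r. q_zigzag q (j k) / q_fact q (j k)))"
    using a(1) by (simp add: field_simps)
  moreover have "a ^ n = (\<xi> * (1 - \<xi>)) powr (real n / 2)"
  proof -
    have "a ^ n = a powr (2 * (real n / 2))"
      using a(1) by (simp add: powr_realpow)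
    also have "\<dots> = (a powr 2) powr (real n / 2)"
      by (rule powr_powr[symmetric])
    also have "a powr 2 = \<xi> * (1 - \<xi>)" using a by simp
    finally show ?thesis .
  qed
  ultimately show ?thesis by (simp only: b_def)
qed

theorem theorem2:
  fixes M :: "'a measure" and X :: "nat \<Rightarrow> 'a \<Rightarrow> real" and \<theta> \<xi> :: real
  assumes "prob_space M"
    and "prob_space.indep_vars M (\<lambda>_. borel) X UNIV"
    and "\<And>i. distributed M lborel (X i) (\<lambda>x. ennreal (two_sided_exp_density \<xi> x))"
    and "0 \<le> \<xi>" and "\<xi> \<le> 1"
    and "\<theta> < 0"
  shows
    "(\<forall>n\<ge>1. persistence_prob M X \<theta> n = persistence_prob M X (1 / \<theta>) n)
   \<and> (\<theta> = - 1 \<and> \<xi> = 1 / 2 \<longrightarrow>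
        (\<forall>z::complex. norm z < 1 \<longrightarrow>
           has_value_cont0
             (\<lambda>w. 2 / w * sin (w / 2) / (cos (w / 2) - sin (w / 2)) - 1)
             z (persistence_gf M X \<theta> z)))
   \<and> (\<forall>z::complex. norm z < 1 \<longrightarrow>
        (0 < \<xi> \<and> \<xi> < 1 \<longrightarrow>
           has_value_cont0 (persistence_gf_formula \<theta> \<xi>) z (persistence_gf M X \<theta> z))
      \<and> (\<xi> = 0 \<longrightarrow>
           (\<exists>v. (\<forall>s\<in>{0<..<1}. has_value_cont0 (persistence_gf_formula \<theta> s) z (v s))
              \<and> (v \<longlongrightarrow> persistence_gf M X \<theta> z) (at_right 0)))
      \<and> (\<xi> = 1 \<longrightarrow>
           (\<exists>v. (\<forall>s\<in>{0<..<1}. has_value_cont0 (persistence_gf_formula \<theta> s) z (v s))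
              \<and> (v \<longlongrightarrow> persistence_gf M X \<theta> z) (at_left 1))))
   \<and> (0 < \<xi> \<and> \<xi> < 1 \<longrightarrow>
        (\<forall>n\<ge>1. persistence_prob M X \<theta> n =
           (\<xi> * (1 - \<xi>)) powr (real n / 2) *
           (\<Sum>r=1..n+1. sqrt ((1 - \<xi>) / \<xi>) ^ (r - 1) *
              (\<Sum>j\<in>odd_compositions r (n + 1).
                 \<Prod>k=1..r. q_zigzag (- \<theta>) (j k) / q_fact (- \<theta>) (j k)))))"
proof -
  interpret prob_space M by fact
  let ?\<nu> = "two_sided_exp \<xi>"
  have d: "distr M borel (X i) = ?\<nu>" for i
  proof -
    have "distr M borel (X i) = distr M lborel (X i)" by (rule distr_cong) simp_all
    also have "\<dots> = ?\<nu>" by (rule distributed_distr_eq_density[OF assms(3)])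
    finally show ?thesis .
  qed
  have prob: "prob_space ?\<nu>"
    using assms(3)[of 0] d[of 0] prob_space_distr[of "X 0" borel]
    by (simp add: distributed_def)
  have q: "- \<theta> > 0" using assms(6) by simp
  have p: "persistence_prob M X \<theta> n = (\<integral>x. persist_from ?\<nu> (- (- \<theta>)) n x \<partial>?\<nu>)" for n
    using persistence_prob_eq_integral[OF assms(2) d] by simp
  note conv = persistence_convolution[OF q assms(4,5) prob, folded p]
  have gf: "persistence_gf M X \<theta> z = persistence_value (- \<theta>) \<xi> z" if "norm z < 1" for z
    unfolding persistence_gf_def
    by (rule persistence_series_eq[OF q assms(4,5) _ that conv]) (simp add: persistence_prob_def)
  have h: "has_value_cont0 (persistence_gf_formula \<theta> s) z (persistence_value (- \<theta>) s z)"
    if "s \<in> {0<..<1}" "norm z < 1" for s z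
    using has_value_cont0_persistence_gf_formula[OF assms(6)] that by auto
  have lim: "((\<lambda>s. persistence_value (- \<theta>) s z) \<longlongrightarrow> persistence_value (- \<theta>) s0 z) (at s0 within A)"
    if "s0 = 0 \<or> s0 = 1" "norm z < 1" for s0 z A
    using isCont_persistence_value[OF q that]
    by (auto simp: isCont_def intro: tendsto_within_subset)
  have gf_value: "has_value_cont0 (persistence_gf_formula \<theta> \<xi>) z (persistence_gf M X \<theta> z)"
    if "0 < \<xi> \<and> \<xi> < 1" "norm z < 1" for z
    unfolding gf[OF that(2)] using that by (intro h) auto
  have half: "persistence_gf_formula (- 1) (1 / 2) =
      (\<lambda>w. 2 / w * sin (w / 2) / (cos (w / 2) - sin (w / 2)) - 1)"
    by (rule ext) (rule persistence_gf_formula_half)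
  \<comment> \<open>The witness is \<open>persistence_value\<close> as a function of
    \<open>s\<close>; the arbitrary set \<open>A\<close> serves the right limit at 0 and the left
    limit at 1 alike.\<close>
  have boundary: "\<exists>v. (\<forall>s\<in>{0<..<1}. has_value_cont0 (persistence_gf_formula \<theta> s) z (v s))
              \<and> (v \<longlongrightarrow> persistence_gf M X \<theta> z) (at s0 within A)"
    if "norm z < 1" "\<xi> = s0" "s0 = 0 \<or> s0 = 1" for z s0 A
    unfolding gf[OF that(1)] that(2)
    using h[OF _ that(1)] lim[OF that(3,1)]
    by (intro exI[of _ "\<lambda>s. persistence_value (- \<theta>) s z"] conjI ballI)
  show ?thesis
  proof (intro conjI allI impI)
    fix n :: nat
    show "persistence_prob M X \<theta> n = persistence_prob M X (1 / \<theta>) n"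
      by (rule persistence_prob_inverse[OF assms(2) d assms(6)])
  next
    fix z :: complex assume "\<theta> = - 1 \<and> \<xi> = 1 / 2" and z: "norm z < 1"
    then have *: "\<theta> = - 1" "\<xi> = 1 / 2" by auto
    have "0 < \<xi> \<and> \<xi> < 1" using * by simp
    from gf_value[OF this z]
    show "has_value_cont0 (\<lambda>w. 2 / w * sin (w / 2) / (cos (w / 2) - sin (w / 2)) - 1)
             z (persistence_gf M X \<theta> z)"
      unfolding * half .
  next
    fix n assume "0 < \<xi> \<and> \<xi> < 1"
    then show "persistence_prob M X \<theta> n =
           (\<xi> * (1 - \<xi>)) powr (real n / 2) *
           (\<Sum>r=1..n+1. sqrt ((1 - \<xi>) / \<xi>) ^ (r - 1) *
              (\<Sum>j\<in>odd_compositions r (n + 1).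
                 \<Prod>k=1..r. q_zigzag (- \<theta>) (j k) / q_fact (- \<theta>) (j k)))"
      by (intro persistence_coefficients[OF q _ _ conv]) auto
  qed (erule gf_value, assumption, (rule boundary; simp)+)
qed

end
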